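(* Let $n\ge1$, let $Q\subset\mathbb R^n$ be a cube, and let $p>0$. Let $\varepsilon_0(p)$, $C(\varepsilon,p)$ and the lower Bellman function $\boldsymbol b_{p,C}$ on $\Omega_C$ be defined as in the context. Assume that there exists a family of functions $\{b_C\}_{C\ge1}$ such that for each $C$ the function $b_C$ is defined on $\Omega_C$, $b_C\le\boldsymbol b_{p,C}$, and $b_C(0,\cdot)$ is continuous on the interval $[1,C]$. Then $$\varepsilon_0(p)^p\ge\limsup_{C\to\infty}b_C(0,C).$$ Furthermore, let $G(C)=\big(b_C(0,C)\big)^{1/p}$. If there exists $C_0\ge1$ such that $G$ is strictly increasing on the interval $[C_0,\infty)$, then $$C(\varepsilon,p)\le G^{-1}(\varepsilon)\qquad\text{for}\quad G(C_0)\le\varepsilon<\varepsilon_0(p),$$ where $G^{-1}$ is the inverse function of $G$ on $[C_0,\infty)$.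
   Context: For a cube $J\subset\mathbb R^n$, $\langle\varphi\rangle_J=\frac1{|J|}\int_J\varphi$. For a cube $Q$ and $p>0$, $\|\varphi\|_{\mathrm{BMO}^p(Q)}=\sup_{J\subset Q}\langle|\varphi-\langle\varphi\rangle_J|^p\rangle_J^{1/p}$, the supremum being over all subcubes $J$ of $Q$; $\mathrm{BMO}(Q)$ is the set of locally integrable $\varphi$ for which this is finite (the set is the same for all $p>0$). An a.e. positive function $w$ is in $A_\infty(Q)$ if $w$ and $\log w$ are locally integrable and $[w]_{A_\infty(Q)}:=\sup_{J\subset Q}\langle w\rangle_Je^{-\langle\log w\rangle_J}<\infty$, the supremum being over all subcubes $J$ of $Q$. The numbers $\varepsilon_0(p)>0$ and $C(\varepsilon,p)$ are the best constants in the integral John–Nirenberg inequality: if $\varphi\in\mathrm{BMO}(Q)$ and $\|\varphi\|_{\mathrm{BMO}^p(Q)}\le\varepsilon<\varepsilon_0(p)$, then $\langle e^\varphi\rangle_J\le C(\varepsilon,p)\,e^{\langle\varphi\rangle_J}$ for every subcube $J\subset Q$. That is, $C(\varepsilon,p)$ is the smallest constant for which this holds for all such $\varphi$ and $J$, and $\varepsilon_0(p)$ is the largest number such that $C(\varepsilon,p)<\infty$ for all $0\le\varepsilon<\varepsilon_0(p)$. These quantities depend on $n$ but not on the choice of the cube $Q$. For $C\ge1$ let $\Omega_C=\{x\in\mathbb R^2:\ e^{x_1}\le x_2\le Ce^{x_1}\}$. For $x=(x_1,x_2)\in\Omega_C$ let $$E_{x,C,Q}=\{\varphi\in L^1(Q):\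 \langle\varphi\rangle_Q=x_1,\ \langle e^\varphi\rangle_Q=x_2,\ [e^\varphi]_{A_\infty(Q)}\le C\},$$ which is non-empty for each $x\in\Omega_C$, and let $$\boldsymbol b_{p,C}(x)=\inf\{\langle|\varphi|^p\rangle_Q:\ \varphi\in E_{x,C,Q}\}.$$
   Formalization: The bound C(ε,p) ≤ G^{-1}(ε) is stated for those ε in [G(C_0), ε_0(p)) that lie in the range of G on [C_0,∞), since elsewhere G^{-1}(ε) is undefined (G need not be continuous or reach ε_0(p)); b_C(0,C) ≥ 0 for C ≥ C_0 is made explicit so that G is defined. *)

theory Defs
  imports "HOL-Analysis.Analysis"
begin

text \<open>Cubes are closed, non-degenerate and have sides parallel to the coordinate axes.\<close>

definition is_cube :: "(real ^ 'n) set \<Rightarrow> bool" where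
  "is_cube J \<longleftrightarrow> (\<exists>a l. 0 < l \<and> J = cbox a (a + vec l))"

definition subcubes :: "(real ^ 'n) set \<Rightarrow> (real ^ 'n) set set" where
  "subcubes Q = {J. is_cube J \<and> J \<subseteq> Q}"

text \<open>Averages come in two forms: \<open>avg\<close> is used for integrable functions only; \<open>nn_avg\<close> is for
  non-negative functions and takes the value \<open>\<infinity>\<close> when the function is not integrable.\<close>

definition avg :: "(real ^ 'n) set \<Rightarrow> (real ^ 'n \<Rightarrow> real) \<Rightarrow> real" where
  "avg J f = (LINT x:J|lebesgue. f x) / measure lebesgue J"

definition nn_avg :: "(real ^ 'n) set \<Rightarrow> (real ^ 'n \<Rightarrow> real) \<Rightarrow> ennreal" where
  "nn_avg J f = (\<integral>\<^sup>+ x\<in>J. ennreal (f x) \<partial>lebesgue) / emeasure lebesgue J"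

text \<open>Real powers on \<open>[0, \<infinity>]\<close>, meant for positive exponents.\<close>

definition enn_powr :: "ennreal \<Rightarrow> real \<Rightarrow> ennreal" where
  "enn_powr x p = (if x = \<infinity> then \<infinity> else ennreal (enn2real x powr p))"

definition BMO_norm :: "(real ^ 'n) set \<Rightarrow> real \<Rightarrow> (real ^ 'n \<Rightarrow> real) \<Rightarrow> ennreal" where
  "BMO_norm Q p \<phi> =
     (SUP J\<in>subcubes Q. enn_powr (nn_avg J (\<lambda>x. \<bar>\<phi> x - avg J \<phi>\<bar> powr p)) (1 / p))"

text \<open>Since \<open>Q\<close> is compact, local integrability on \<open>Q\<close> is integrability on \<open>Q\<close>.\<close>

definition BMO :: "(real ^ 'n) set \<Rightarrow> real \<Rightarrow> (real ^ 'n \<Rightarrow> real) set" where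
  "BMO Q p = {\<phi>. \<phi> absolutely_integrable_on Q \<and> BMO_norm Q p \<phi> < \<infinity>}"

definition A_infty_const :: "(real ^ 'n) set \<Rightarrow> (real ^ 'n \<Rightarrow> real) \<Rightarrow> ennreal" where
  "A_infty_const Q w =
     (SUP J\<in>subcubes Q. nn_avg J w * ennreal (exp (- avg J (\<lambda>x. ln (w x)))))"

definition A_infty :: "(real ^ 'n) set \<Rightarrow> (real ^ 'n \<Rightarrow> real) set" where
  "A_infty Q = {w. (AE x in lebesgue. x \<in> Q \<longrightarrow> 0 < w x) \<and>
     w absolutely_integrable_on Q \<and> (\<lambda>x. ln (w x)) absolutely_integrable_on Q \<and>
     A_infty_const Q w < \<infinity>}"

text \<open>The best constant \<open>C(\<epsilon>,p)\<close> in the integral John--Nirenberg inequality, equal to \<open>\<infinity>\<close> if no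
  finite constant works, and the threshold \<open>\<epsilon>\<^sub>0(p)\<close>.\<close>

definition JN_const :: "(real ^ 'n) set \<Rightarrow> real \<Rightarrow> real \<Rightarrow> ennreal" where
  "JN_const Q \<epsilon> p = Inf {c. \<forall>\<phi>\<in>BMO Q p. BMO_norm Q p \<phi> \<le> ennreal \<epsilon> \<longrightarrow>
     (\<forall>J\<in>subcubes Q. nn_avg J (\<lambda>x. exp (\<phi> x)) \<le> c * ennreal (exp (avg J \<phi>)))}"

definition JN_eps0 :: "(real ^ 'n) set \<Rightarrow> real \<Rightarrow> ennreal" where
  "JN_eps0 Q p = Sup {r. \<forall>\<epsilon>\<ge>0. ennreal \<epsilon> < r \<longrightarrow> JN_const Q \<epsilon> p < \<infinity>}"

definition Omega :: "real \<Rightarrow> (real \<times> real) set" where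
  "Omega C = {(x1, x2). exp x1 \<le> x2 \<and> x2 \<le> C * exp x1}"

definition E_class :: "real \<times> real \<Rightarrow> real \<Rightarrow> (real ^ 'n) set \<Rightarrow> (real ^ 'n \<Rightarrow> real) set" where
  "E_class x C Q = {\<phi>. \<phi> absolutely_integrable_on Q \<and>
     avg Q \<phi> = fst x \<and> avg Q (\<lambda>y. exp (\<phi> y)) = snd x \<and>
     (\<lambda>y. exp (\<phi> y)) \<in> A_infty Q \<and> A_infty_const Q (\<lambda>y. exp (\<phi> y)) \<le> ennreal C}"

definition lower_bellman :: "(real ^ 'n) set \<Rightarrow> real \<Rightarrow> real \<Rightarrow> real \<times> real \<Rightarrow> ennreal" where
  "lower_bellman Q p C x = (INF \<phi>\<in>E_class x C Q. nn_avg Q (\<lambda>y. \<bar>\<phi> y\<bar> powr p))"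

end

theory Submission
  imports Defs "HOL-Probability.Probability_Measure" "HOL-Real_Asymp.Real_Asymp"
begin

text \<open>
  If \<open>C = [e\<^sup>\<eta>]\<close> is finite, then on a nearly extremal subcube \<open>J\<close> the function \<open>\<eta> - \<langle>\<eta>\<rangle>\<^sub>J\<close>, moved to \<open>Q\<close> by an
  affine map, is admissible for the Bellman function at a point \<open>(0, t)\<close> with \<open>t\<close> close to \<open>C\<close>; by
  continuity \<open>b\<^sub>C(0, C)\<close> is at most the \<open>p\<close>-th power of the norm of \<open>\<eta>\<close>. This gives the bound on
  \<open>C(\<epsilon>, p)\<close>, where finiteness of \<open>[e\<^sup>\<phi>]\<close> is known in advance.

  For the bound on \<open>\<epsilon>\<^sub>0(p)\<close> let \<open>b\<^sub>C(0, C) > \<epsilon>\<^sup>p\<close> and suppose that \<open>\<phi>\<close> has norm less than \<open>\<epsilon>\<close> but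
  \<open>[e\<^sup>\<phi>] > C\<close>, possibly infinite. The bounded functions \<open>\<psi> = N arctan (\<phi>/N)\<close> still have norm at most
  \<open>\<epsilon>\<close> and \<open>[e\<^sup>\<psi>] > C\<close> for large \<open>N\<close>; the error terms are controlled by higher moments of the oscillation
  of \<open>\<phi>\<close>, which are finite by a John--Nirenberg stopping-time argument valid for every \<open>p > 0\<close>. Since
  \<open>s \<mapsto> [e\<^bsup>s\<psi>\<^esup>]\<close> is Lipschitz on \<open>[0, 1]\<close>, it takes the value \<open>C\<close>, and the first step contradicts the
  choice of \<open>C\<close>.
\<close>

section \<open>Averages over cubes\<close>

lemma is_cube_lmeasurable: "is_cube J \<Longrightarrow> J \<in> lmeasurable"
  unfolding is_cube_def by auto

lemma measure_cube:
  fixes a :: "real ^ 'n"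
  assumes "0 < l"
  shows "measure lebesgue (cbox a (a + vec l)) = l ^ CARD('n)"
  using assms by (simp add: content_cbox_if_cart interval_eq_empty_cart)

lemma measure_cube_pos: "is_cube (J :: (real ^ 'n) set) \<Longrightarrow> 0 < measure lebesgue J"
  unfolding is_cube_def using measure_cube[where 'n='n] by (metis zero_less_power)

lemma emeasure_cube:
  assumes "is_cube J"
  shows "emeasure lebesgue J = ennreal (measure lebesgue J)"
    "emeasure lebesgue J \<noteq> 0" "emeasure lebesgue J \<noteq> \<infinity>" "J \<in> sets lebesgue"
  using is_cube_lmeasurable[OF assms] measure_cube_pos[OF assms]
  by (auto simp: emeasure_eq_measure2 fmeasurableD)

lemma subcubes_self: "is_cube Q \<Longrightarrow> Q \<in> subcubes Q"
  by (simp add: subcubes_def)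

lemma subcubes_is_cube: "J \<in> subcubes Q \<Longrightarrow> is_cube J"
  by (simp add: subcubes_def)

text \<open>Normalised Lebesgue measure turns averages over \<open>J\<close> into expectations, so
  that integral inequalities on a probability space can be used throughout.\<close>

abbreviation cube_prob :: "(real ^ 'n) set \<Rightarrow> (real ^ 'n) measure" where
  "cube_prob J \<equiv> uniform_measure lebesgue J"

lemma prob_space_cube_prob: "is_cube J \<Longrightarrow> prob_space (cube_prob J)"
  using emeasure_cube by (intro prob_space_uniform_measure) auto

lemma measure_cube_prob_UNIV: "is_cube J \<Longrightarrow> measure (cube_prob J) UNIV = 1"
  using prob_space.prob_space[OF prob_space_cube_prob] by fastforce

lemma nn_avg_cube_prob:
  assumes "is_cube J" "f \<in> borel_measurable lebesgue"
  shows "nn_avg J f = (\<integral>\<^sup>+x. ennreal (f x) \<partial>cube_prob J)"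
  unfolding nn_avg_def using assms emeasure_cube(4)[OF assms(1)]
  by (subst nn_integral_uniform_measure) auto

lemma cube_prob_density:
  assumes "is_cube J"
  shows "cube_prob J = density lebesgue (\<lambda>x. ennreal (indicator J x / measure lebesgue J))"
  unfolding uniform_measure_def using emeasure_cube(1)[OF assms] measure_cube_pos[OF assms]
  by (intro arg_cong[where f="density lebesgue"])
     (auto simp: fun_eq_iff divide_ennreal simp flip: ennreal_indicator)

lemma avg_cube_prob:
  assumes "is_cube J" "f \<in> borel_measurable lebesgue"
  shows "avg J f = (\<integral>x. f x \<partial>cube_prob J)"
proof -
  have "(\<integral>x. f x \<partial>cube_prob J) = (\<integral>x. (indicator J x / measure lebesgue J) *\<^sub>R f x \<partial>lebesgue)"
    unfolding cube_prob_density[OF assms(1)] using assms emeasure_cube(4)[OF assms(1)]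
    by (intro integral_density) auto
  also have "\<dots> = avg J f"
    by (simp add: avg_def set_lebesgue_integral_def)
  finally show ?thesis ..
qed

lemma absolutely_integrable_on_cube_iff:
  fixes f :: "real ^ 'n \<Rightarrow> real"
  assumes "is_cube J" "f \<in> borel_measurable lebesgue"
  shows "f absolutely_integrable_on J \<longleftrightarrow> integrable (cube_prob J) f"
proof -
  have "integrable (cube_prob J) f \<longleftrightarrow>
      integrable lebesgue (\<lambda>x. (indicator J x / measure lebesgue J) *\<^sub>R f x)"
    unfolding cube_prob_density[OF assms(1)] using assms emeasure_cube(4)[OF assms(1)]
    by (intro integrable_density) auto
  also have "(\<lambda>x. (indicator J x / measure lebesgue J) *\<^sub>R f x) =
      (\<lambda>x. inverse (measure lebesgue J) * (indicator J x *\<^sub>R f x))"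
    by (simp add: divide_inverse mult_ac)
  also have "integrable lebesgue \<dots> \<longleftrightarrow> f absolutely_integrable_on J"
    using measure_cube_pos[OF assms(1)] unfolding set_integrable_def
    by (subst integrable_mult_left_iff) auto
  finally show ?thesis ..
qed

lemma integrable_subcube:
  fixes f :: "real ^ 'n \<Rightarrow> real"
  assumes "is_cube Q" "J \<in> subcubes Q" "f \<in> borel_measurable lebesgue" "integrable (cube_prob Q) f"
  shows "integrable (cube_prob J) f"
proof -
  have "is_cube J" "J \<subseteq> Q" using assms by (auto simp: subcubes_def)
  moreover have "f absolutely_integrable_on Q"
    using assms by (simp add: absolutely_integrable_on_cube_iff)
  ultimately have "f absolutely_integrable_on J"
    using emeasure_cube(4)[of J] set_integrable_subset by blast
  then show ?thesis using assms \<open>is_cube J\<close> by (simp add: absolutely_integrable_on_cube_iff)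
qed

lemma nn_avg_eq_avg:
  assumes "is_cube J" "f \<in> borel_measurable lebesgue" "integrable (cube_prob J) f" "\<And>x. 0 \<le> f x"
  shows "nn_avg J f = ennreal (avg J f)"
  using assms by (simp add: nn_avg_cube_prob avg_cube_prob nn_integral_eq_integral)

section \<open>Affine maps\<close>

lemma affine_map_measurable:
  fixes v :: "'a::euclidean_space"
  assumes "c > 0"
  shows "(\<lambda>x. v + c *\<^sub>R x) \<in> lebesgue \<rightarrow>\<^sub>M lebesgue"
proof -
  \<comment> \<open>The map is rewritten in coordinates, with the same factor \<open>c\<close> on
    every axis, to match \<open>lebesgue_affine_measurable\<close>.\<close>
  have "(\<lambda>x. v + (\<Sum>j\<in>Basis. (c * (x \<bullet> j)) *\<^sub>R j)) = (\<lambda>x. v + c *\<^sub>R x)"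
    by (simp add: euclidean_representation flip: scaleR_scaleR scaleR_sum_right)
  with lebesgue_affine_measurable[of "\<lambda>_. c" v] assms show ?thesis by simp
qed

lemma affine_image_cube:
  fixes v :: "real ^ 'n"
  assumes "c > 0"
  shows "(\<lambda>x. v + c *\<^sub>R x) ` cbox a (a + vec l) = cbox (v + c *\<^sub>R a) (v + c *\<^sub>R a + vec (c * l))"
proof (intro equalityI subsetI)
  fix y assume y: "y \<in> cbox (v + c *\<^sub>R a) (v + c *\<^sub>R a + vec (c * l))"
  then have "(1/c) *\<^sub>R (y - v) \<in> cbox a (a + vec l)"
    using assms by (auto simp: mem_box_cart field_simps)
  moreover have "y = v + c *\<^sub>R ((1/c) *\<^sub>R (y - v))" using assms by simp
  ultimately show "y \<in> (\<lambda>x. v + c *\<^sub>R x) ` cbox a (a + vec l)" by blast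
next
  fix y assume "y \<in> (\<lambda>x. v + c *\<^sub>R x) ` cbox a (a + vec l)"
  then obtain x where x: "y = v + c *\<^sub>R x" "\<And>i. a $ i \<le> x $ i" "\<And>i. x $ i \<le> a $ i + l"
    by (fastforce simp: mem_box_cart)
  have "c * a $ i \<le> c * x $ i \<and> c * x $ i \<le> c * a $ i + c * l" for i
    using x(2,3)[of i] assms by (metis distrib_left less_imp_le mult_left_mono)
  then show "y \<in> cbox (v + c *\<^sub>R a) (v + c *\<^sub>R a + vec (c * l))"
    by (simp add: x(1) mem_box_cart algebra_simps)
qed

lemma is_cube_affine_image:
  assumes "c > 0" "is_cube K"
  shows "is_cube ((\<lambda>x. v + c *\<^sub>R x) ` K)"
proof -
  obtain a l where "0 < l" "K = cbox a (a + vec l)"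
    using assms(2) unfolding is_cube_def by blast
  then show ?thesis
    using assms(1) affine_image_cube[OF assms(1), of v a l] mult_pos_pos
    unfolding is_cube_def by blast
qed

lemma cubes_affine_equivalent:
  fixes Q J :: "(real ^ 'n) set"
  assumes "is_cube Q" "is_cube J"
  obtains v c where "c > 0" "J = (\<lambda>x. v + c *\<^sub>R x) ` Q"
proof -
  from assms obtain a l a' l' where *: "0 < l" "Q = cbox a (a + vec l)" "0 < l'" "J = cbox a' (a' + vec l')"
    unfolding is_cube_def by blast
  have "J = (\<lambda>x. (a' - (l'/l) *\<^sub>R a) + (l'/l) *\<^sub>R x) ` Q"
    using * affine_image_cube[of "l'/l" "a' - (l'/l) *\<^sub>R a" a l] by simp
  with * show ?thesis by (intro that[of "l'/l"]) auto
qed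

text \<open>Numerator and denominator of the normalised measure both scale by
  \<open>c ^ CARD('n)\<close>, and the factor cancels. All transfers of averages between cubes rest
  on this.\<close>

lemma cube_prob_affine_image:
  fixes v :: "real ^ 'n"
  assumes c: "c > 0" and K: "is_cube K"
  shows "cube_prob ((\<lambda>x. v + c *\<^sub>R x) ` K) = distr (cube_prob K) lebesgue (\<lambda>x. v + c *\<^sub>R x)"
    (is "cube_prob (?T ` K) = _")
proof (rule measure_eqI)
  fix A assume "A \<in> sets (cube_prob (?T ` K))"
  then have A[measurable]: "A \<in> sets lebesgue" by simp
  note T[measurable] = affine_map_measurable[OF c, of v]
  have pre: "?T -` A \<in> sets lebesgue" using measurable_sets[OF T A] by simp
  have em: "emeasure lebesgue (?T ` S) = ennreal (c ^ CARD('n)) * emeasure lebesgue S" for S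
    using emeasure_lebesgue_affine[of c v S] c by (simp add: add.commute)
  have "?T ` K \<inter> A = ?T ` (K \<inter> ?T -` A)" by auto
  then have "emeasure (cube_prob (?T ` K)) A =
      (ennreal (c ^ CARD('n)) * emeasure lebesgue (K \<inter> ?T -` A)) / (ennreal (c ^ CARD('n)) * emeasure lebesgue K)"
    using A emeasure_cube(4)[OF is_cube_affine_image[OF c K, of v]] by (simp add: em)
  also have "\<dots> = emeasure lebesgue (K \<inter> ?T -` A) / emeasure lebesgue K"
  \<comment> \<open>The factor is cancelled between real-valued measures; both are finite because
    \<open>K\<close> has finite measure.\<close>
  proof -
    have "K \<inter> ?T -` A \<in> lmeasurable"
      using fmeasurable_Int_fmeasurable[OF is_cube_lmeasurable[OF K] pre] .
    then have "emeasure lebesgue (K \<inter> ?T -` A) = ennreal (measure lebesgue (K \<inter> ?T -` A))"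
      by (rule emeasure_eq_measure2)
    then show ?thesis
      using c measure_cube_pos[OF K] by (simp add: emeasure_cube(1)[OF K] divide_ennreal flip: ennreal_mult)
  qed
  also have "\<dots> = emeasure (distr (cube_prob K) lebesgue ?T) A"
    using emeasure_cube(4)[OF K] pre by (subst emeasure_distr) auto
  finally show "emeasure (cube_prob (?T ` K)) A = emeasure (distr (cube_prob K) lebesgue ?T) A" .
qed simp

lemma
  fixes v :: "real ^ 'n" and f :: "real ^ 'n \<Rightarrow> real"
  assumes c: "c > 0" and K: "is_cube K" and f[measurable]: "f \<in> borel_measurable lebesgue"
  shows avg_affine_image: "avg ((\<lambda>x. v + c *\<^sub>R x) ` K) f = avg K (\<lambda>x. f (v + c *\<^sub>R x))"
    and nn_avg_affine_image: "nn_avg ((\<lambda>x. v + c *\<^sub>R x) ` K) f = nn_avg K (\<lambda>x. f (v + c *\<^sub>R x))"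
    and integrable_affine_image: "integrable (cube_prob ((\<lambda>x. v + c *\<^sub>R x) ` K)) f \<longleftrightarrow>
      integrable (cube_prob K) (\<lambda>x. f (v + c *\<^sub>R x))"
proof -
  note T[measurable] = affine_map_measurable[OF c, of v]
  note K' = is_cube_affine_image[OF c K, of v]
  show "avg ((\<lambda>x. v + c *\<^sub>R x) ` K) f = avg K (\<lambda>x. f (v + c *\<^sub>R x))"
    using K K' by (simp add: avg_cube_prob cube_prob_affine_image[OF c K] integral_distr)
  show "nn_avg ((\<lambda>x. v + c *\<^sub>R x) ` K) f = nn_avg K (\<lambda>x. f (v + c *\<^sub>R x))"
    using K K' by (simp add: nn_avg_cube_prob cube_prob_affine_image[OF c K] nn_integral_distr)
  show "integrable (cube_prob ((\<lambda>x. v + c *\<^sub>R x) ` K)) f \<longleftrightarrow>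
      integrable (cube_prob K) (\<lambda>x. f (v + c *\<^sub>R x))"
    using K K' by (simp add: cube_prob_affine_image[OF c K] integrable_distr_eq)
qed

section \<open>Near-extremal subcubes\<close>

text \<open>Jensen's inequality for the exponential, from \<open>1 + u \<le> exp u\<close> with
  \<open>u = \<eta> x - m\<close>, whose mean is 0. It places the points \<open>(0, t)\<close> below
  in the range \<open>1 \<le> t\<close>.\<close>

lemma avg_exp_ge_1:
  fixes J :: "(real ^ 'n) set"
  assumes J: "is_cube J" and [measurable]: "\<eta> \<in> borel_measurable lebesgue"
    and int: "integrable (cube_prob J) \<eta>" "integrable (cube_prob J) (\<lambda>x. exp (\<eta> x))"
  shows "1 \<le> avg J (\<lambda>x. exp (\<eta> x)) * exp (- avg J \<eta>)"
proof -
  interpret prob_space "cube_prob J" by (rule prob_space_cube_prob[OF J])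
  define m where "m = avg J \<eta>"
  have m: "m = (\<integral>x. \<eta> x \<partial>cube_prob J)" using J by (simp add: m_def avg_cube_prob)
  have "1 = (\<integral>x. 1 + (\<eta> x - m) \<partial>cube_prob J)"
    using int by (simp add: m measure_cube_prob_UNIV[OF J])
  also have "\<dots> \<le> (\<integral>x. exp (\<eta> x) * exp (- m) \<partial>cube_prob J)"
    using int exp_ge_add_one_self[of "\<eta> x - m" for x]
    by (intro integral_mono) (auto simp: exp_diff exp_minus divide_inverse)
  also have "\<dots> = avg J (\<lambda>x. exp (\<eta> x)) * exp (- m)"
    using J by (simp add: avg_cube_prob)
  finally show ?thesis by (simp add: m_def)
qed

text \<open>Recentre \<eta> at its mean over \<open>J\<close> and pull it back to \<open>Q\<close>
  by the affine map from \<open>Q\<close> onto \<open>J\<close>. Subcubes of \<open>Q\<close> go to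
  subcubes of \<open>J\<close>, hence of \<open>Q\<close>, so the \<open>A_infty\<close> constant
  does not grow, while the \<open>p\<close>-mean over \<open>Q\<close> becomes the oscillation over
  \<open>J\<close>.\<close>

lemma E_class_transplant:
  fixes Q J :: "(real ^ 'n) set"
  assumes Q: "is_cube Q" and J: "J \<in> subcubes Q" and meas[measurable]: "\<eta> \<in> borel_measurable lebesgue"
    and int: "integrable (cube_prob Q) \<eta>" "integrable (cube_prob Q) (\<lambda>x. exp (\<eta> x))"
    and A: "A_infty_const Q (\<lambda>x. exp (\<eta> x)) \<le> ennreal C"
  shows "\<exists>\<psi> \<in> E_class (0, avg J (\<lambda>x. exp (\<eta> x)) * exp (- avg J \<eta>)) C Q.
      nn_avg Q (\<lambda>y. \<bar>\<psi> y\<bar> powr p) = nn_avg J (\<lambda>x. \<bar>\<eta> x - avg J \<eta>\<bar> powr p)"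
proof -
  have cJ: "is_cube J" using J by (simp add: subcubes_def)
  obtain v c where c: "c > 0" and JT: "J = (\<lambda>x. v + c *\<^sub>R x) ` Q"
    using cubes_affine_equivalent[OF Q cJ] .
  define m where "m = avg J \<eta>"
  define \<psi> where "\<psi> = (\<lambda>y. \<eta> (v + c *\<^sub>R y) - m)"
  note T[measurable] = affine_map_measurable[OF c, of v]
  have \<psi>[measurable]: "\<psi> \<in> borel_measurable lebesgue" by (simp add: \<psi>_def)
  have intJ: "integrable (cube_prob J) \<eta>" "integrable (cube_prob J) (\<lambda>x. exp (\<eta> x))"
    using int integrable_subcube[OF Q J] by auto
  interpret prob_space "cube_prob Q" by (rule prob_space_cube_prob[OF Q])
  have i1: "integrable (cube_prob Q) (\<lambda>x. \<eta> (v + c *\<^sub>R x))"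
    using integrable_affine_image[OF c Q meas, of v] intJ JT by simp
  have i2: "integrable (cube_prob Q) (\<lambda>x. exp (\<eta> (v + c *\<^sub>R x)))"
    using integrable_affine_image[OF c Q, of "\<lambda>x. exp (\<eta> x)" v] intJ JT by simp
  have I\<psi>: "integrable (cube_prob Q) \<psi>" using i1 by (simp add: \<psi>_def)
  have Ie\<psi>: "integrable (cube_prob Q) (\<lambda>x. exp (\<psi> x))"
    using i2 by (simp add: \<psi>_def exp_diff)
  have avg_sub: "avg K \<psi> = avg ((\<lambda>x. v + c *\<^sub>R x) ` K) \<eta> - m" if "K \<in> subcubes Q" for K
  proof -
    have K: "is_cube K" using that by (simp add: subcubes_def)
    interpret PK: prob_space "cube_prob K" by (rule prob_space_cube_prob[OF K])
    have "integrable (cube_prob K) (\<lambda>x. \<eta> (v + c *\<^sub>R x))"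
      using integrable_subcube[OF Q that _ i1] by simp
    then show ?thesis
      using K c by (simp add: avg_affine_image \<psi>_def avg_cube_prob measure_cube_prob_UNIV)
  qed
  have nn_sub: "nn_avg K (\<lambda>x. exp (\<psi> x)) = nn_avg ((\<lambda>x. v + c *\<^sub>R x) ` K) (\<lambda>x. exp (\<eta> x)) * ennreal (exp (- m))"
    if "K \<in> subcubes Q" for K
  proof -
    have K: "is_cube K" using that by (simp add: subcubes_def)
    show ?thesis
      using K c by (simp add: nn_avg_affine_image \<psi>_def nn_avg_cube_prob exp_diff divide_inverse
        ennreal_mult exp_minus nn_integral_multc)
  qed
  have Asub: "A_infty_const Q (\<lambda>x. exp (\<psi> x)) \<le> ennreal C"
    unfolding A_infty_const_def
  proof (rule SUP_least)
    fix K assume K: "K \<in> subcubes Q"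
    let ?K = "(\<lambda>x. v + c *\<^sub>R x) ` K"
    have "is_cube ?K" using K c is_cube_affine_image by (auto simp: subcubes_def)
    moreover have "?K \<subseteq> Q" using K J JT by (auto simp: subcubes_def)
    ultimately have K': "?K \<in> subcubes Q" by (simp add: subcubes_def)
    \<comment> \<open>The factors \<open>exp (- m)\<close> and \<open>exp m\<close> cancel: the
      quotient is invariant under adding a constant to the exponent.\<close>
    have "nn_avg K (\<lambda>x. exp (\<psi> x)) * ennreal (exp (- avg K (\<lambda>x. ln (exp (\<psi> x))))) =
      nn_avg ?K (\<lambda>x. exp (\<eta> x)) * (ennreal (exp (- m)) * ennreal (exp (m - avg ?K \<eta>)))"
      using K by (simp add: nn_sub avg_sub mult.assoc)
    also have "\<dots> = nn_avg ?K (\<lambda>x. exp (\<eta> x)) * ennreal (exp (- avg ?K (\<lambda>x. ln (exp (\<eta> x)))))"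
      by (simp flip: ennreal_mult exp_add)
    also have "\<dots> \<le> A_infty_const Q (\<lambda>x. exp (\<eta> x))"
      unfolding A_infty_const_def using K' by (rule SUP_upper)
    finally show "nn_avg K (\<lambda>x. exp (\<psi> x)) * ennreal (exp (- avg K (\<lambda>x. ln (exp (\<psi> x))))) \<le> ennreal C"
      using A by simp
  qed
  have "avg Q \<psi> = 0" using avg_sub[OF subcubes_self[OF Q]] by (simp add: m_def JT)
  moreover have "avg Q (\<lambda>x. exp (\<psi> x)) = avg J (\<lambda>x. exp (\<eta> x)) * exp (- m)"
    using Q c by (simp add: JT avg_affine_image \<psi>_def avg_cube_prob exp_diff divide_inverse exp_minus)
  moreover have "(\<lambda>x. exp (\<psi> x)) \<in> A_infty Q"
    unfolding A_infty_def using I\<psi> Ie\<psi> Q Asub ennreal_less_top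
    by (auto simp: absolutely_integrable_on_cube_iff intro: le_less_trans)
  ultimately have "\<psi> \<in> E_class (0, avg J (\<lambda>x. exp (\<eta> x)) * exp (- avg J \<eta>)) C Q"
    unfolding E_class_def using Q I\<psi> Asub by (simp add: absolutely_integrable_on_cube_iff m_def)
  moreover have "nn_avg Q (\<lambda>y. \<bar>\<psi> y\<bar> powr p) = nn_avg J (\<lambda>x. \<bar>\<eta> x - m\<bar> powr p)"
    using nn_avg_affine_image[OF c Q, of "\<lambda>x. \<bar>\<eta> x - m\<bar> powr p" v] by (simp add: JT \<psi>_def)
  ultimately show ?thesis unfolding m_def by blast
qed

text \<open>The supremum \<open>C\<close> need not be attained, so a subcube whose quotient
  \<open>t\<close> is close to \<open>C\<close> is transplanted to \<open>Q\<close>. The resulting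
  function competes in the infimum at \<open>(0, t)\<close>, which gives
  \<open>\<beta> t \<le> \<kappa>\<close>; continuity of \<beta> at \<open>C\<close> carries this to
  \<open>C\<close>.\<close>

lemma bellman_minorant_le_oscillation:
  fixes Q :: "(real ^ 'n) set"
  assumes Q: "is_cube Q" and meas[measurable]: "\<eta> \<in> borel_measurable lebesgue"
    and int: "integrable (cube_prob Q) \<eta>" "integrable (cube_prob Q) (\<lambda>x. exp (\<eta> x))"
    and A: "A_infty_const Q (\<lambda>x. exp (\<eta> x)) = ennreal C" and C: "1 \<le> C"
    and osc: "\<And>J. J \<in> subcubes Q \<Longrightarrow> nn_avg J (\<lambda>x. \<bar>\<eta> x - avg J \<eta>\<bar> powr p) \<le> ennreal \<kappa>" and "0 \<le> \<kappa>"
    and bell: "\<And>t. 1 \<le> t \<Longrightarrow> t \<le> C \<Longrightarrow> ereal (\<beta> t) \<le> enn2ereal (lower_bellman Q p C (0, t))"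
    and cont: "continuous_on {1..C} \<beta>"
  shows "\<beta> C \<le> \<kappa>"
proof (rule ccontr)
  assume "\<not> \<beta> C \<le> \<kappa>"
  then have "\<beta> C - \<kappa> > 0" by simp
  \<comment> \<open>The tolerance is the whole gap \<open>\<beta> C - \<kappa>\<close>, so
    \<open>\<beta> t\<close> still exceeds \<kappa> within distance \<open>d\<close> of
    \<open>C\<close>.\<close>
  then obtain d where d: "d > 0" "\<And>t. t \<in> {1..C} \<Longrightarrow> dist t C < d \<Longrightarrow> dist (\<beta> t) (\<beta> C) < \<beta> C - \<kappa>"
    using cont C unfolding continuous_on_iff by (metis atLeastAtMost_iff order_refl)
  \<comment> \<open>If \<open>C - d\<close> is negative, \<open>ennreal\<close> sends it to 0, which
    is still below \<open>ennreal C\<close>.\<close>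
  have "ennreal (C - d) < (SUP J\<in>subcubes Q. nn_avg J (\<lambda>x. exp (\<eta> x)) * ennreal (exp (- avg J (\<lambda>x. ln (exp (\<eta> x))))))"
    using A d C unfolding A_infty_const_def by (simp add: ennreal_lessI)
  then obtain J where J: "J \<in> subcubes Q"
    and less: "ennreal (C - d) < nn_avg J (\<lambda>x. exp (\<eta> x)) * ennreal (exp (- avg J \<eta>))"
    unfolding less_SUP_iff by auto
  have cJ: "is_cube J" using J by (simp add: subcubes_def)
  have intJ: "integrable (cube_prob J) \<eta>" "integrable (cube_prob J) (\<lambda>x. exp (\<eta> x))"
    using int integrable_subcube[OF Q J] by auto
  define t where "t = avg J (\<lambda>x. exp (\<eta> x)) * exp (- avg J \<eta>)"
  have t1: "1 \<le> t" unfolding t_def by (rule avg_exp_ge_1[OF cJ meas intJ])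
  have nnt: "nn_avg J (\<lambda>x. exp (\<eta> x)) * ennreal (exp (- avg J \<eta>)) = ennreal t"
    using cJ intJ by (simp add: nn_avg_eq_avg t_def ennreal_mult'')
  have "ennreal t \<le> ennreal C"
    unfolding A[symmetric] A_infty_const_def nnt[symmetric] by (rule SUP_upper2[OF J]) simp
  then have tC: "t \<le> C" using C by simp
  have "C - d < t" using less unfolding nnt by (metis ennreal_leI not_le)
  then have "dist t C < d" using tC by (simp add: dist_real_def)
  then have "\<beta> t > \<kappa>" using d(2)[of t] t1 tC by (auto simp: dist_real_def)
  moreover obtain \<psi> where "\<psi> \<in> E_class (0, t) C Q"
      "nn_avg Q (\<lambda>y. \<bar>\<psi> y\<bar> powr p) = nn_avg J (\<lambda>x. \<bar>\<eta> x - avg J \<eta>\<bar> powr p)"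
    using E_class_transplant[OF Q J meas int, of C p] A unfolding t_def by auto
  then have "lower_bellman Q p C (0, t) \<le> ennreal \<kappa>"
    unfolding lower_bellman_def using osc[OF J] by (metis INF_lower2)
  then have "ereal (\<beta> t) \<le> enn2ereal (ennreal \<kappa>)"
    using bell[OF t1 tC] by (meson less_eq_ennreal.rep_eq order_trans)
  then have "\<beta> t \<le> \<kappa>" using \<open>0 \<le> \<kappa>\<close> by simp
  ultimately show False by simp
qed

section \<open>Dyadic stopping cubes\<close>

definition dyadic :: "real ^ 'n \<Rightarrow> real \<Rightarrow> nat \<Rightarrow> real ^ 'n \<Rightarrow> (real ^ 'n) set" where
  "dyadic a l k x = {y. \<forall>i. \<lfloor>2 ^ k * ((y $ i - a $ i) / l)\<rfloor> = \<lfloor>2 ^ k * ((x $ i - a $ i) / l)\<rfloor>}"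

text \<open>\<open>dyadic a l k x\<close> is the half-open cube containing \<open>x\<close> of the \<open>k\<close>-th dyadic generation of the
  grid with origin \<open>a\<close> and mesh \<open>l\<close>; \<open>dyadic_cube\<close> is its closure.\<close>

definition dyadic_corner :: "real ^ 'n \<Rightarrow> real \<Rightarrow> nat \<Rightarrow> real ^ 'n \<Rightarrow> real ^ 'n" where
  "dyadic_corner a l k x = (\<chi> i. a $ i + l / 2 ^ k * \<lfloor>2 ^ k * ((x $ i - a $ i) / l)\<rfloor>)"

definition dyadic_cube :: "real ^ 'n \<Rightarrow> real \<Rightarrow> nat \<Rightarrow> real ^ 'n \<Rightarrow> (real ^ 'n) set" where
  "dyadic_cube a l k x = cbox (dyadic_corner a l k x) (dyadic_corner a l k x + vec (l / 2 ^ k))"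

lemma dyadic_self: "x \<in> dyadic a l k x"
  by (simp add: dyadic_def)

lemma dyadic_eq: "y \<in> dyadic a l k x \<Longrightarrow> dyadic a l k y = dyadic a l k x"
  by (auto simp: dyadic_def)

lemma dyadic_antimono:
  assumes "j \<le> k"
  shows "dyadic a l k x \<subseteq> dyadic a l j x"
proof -
  \<comment> \<open>The index in a coarser generation is an integer quotient of the finer index, so
    equal fine indices force equal coarse ones.\<close>
  have "\<lfloor>2 ^ j * t\<rfloor> = \<lfloor>2 ^ k * t\<rfloor> div 2 ^ (k - j)" for t :: real
  proof -
    obtain d where "k = j + d" using assms by (metis le_add_diff_inverse)
    then have "2 ^ j * t = (2 ^ k * t) / real_of_int (2 ^ (k - j))"
      by (simp add: power_add)
    then show ?thesis using floor_divide_real_eq_div[of "2 ^ (k - j)" "2 ^ k * t"] by simp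
  qed
  then show ?thesis by (simp add: subset_iff dyadic_def del: times_divide_eq_right)
qed

lemma dyadic_iff:
  assumes "l > 0"
  shows "y \<in> dyadic a l k x \<longleftrightarrow>
    (\<forall>i. dyadic_corner a l k x $ i \<le> y $ i \<and> y $ i < dyadic_corner a l k x $ i + l / 2 ^ k)"
proof -
  have "\<lfloor>2 ^ k * ((t - s) / l)\<rfloor> = m \<longleftrightarrow> s + l / 2 ^ k * m \<le> t \<and> t < s + l / 2 ^ k * m + l / 2 ^ k"
    for t s :: real and m :: int
    unfolding floor_eq_iff using assms by (simp add: field_simps)
  then show ?thesis by (simp add: dyadic_def dyadic_corner_def)
qed

lemma box_subset_dyadic:
  "l > 0 \<Longrightarrow> box (dyadic_corner a l k x) (dyadic_corner a l k x + vec (l / 2 ^ k)) \<subseteq> dyadic a l k x"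
  by (auto simp: subset_iff dyadic_iff mem_box_cart less_imp_le)

lemma is_cube_dyadic_cube: "l > 0 \<Longrightarrow> is_cube (dyadic_cube a l k x)"
  unfolding is_cube_def dyadic_cube_def by (intro exI[of _ "dyadic_corner a l k x"] exI[of _ "l / 2 ^ k"]) simp

lemma dyadic_subset_dyadic_cube: "l > 0 \<Longrightarrow> dyadic a l k x \<subseteq> dyadic_cube a l k x"
  by (auto simp: dyadic_iff dyadic_cube_def mem_box_cart less_imp_le)

lemma dyadic_cube_root: "l > 0 \<Longrightarrow> dyadic_cube a l 0 a = cbox a (a + vec l)"
  by (simp add: dyadic_cube_def dyadic_corner_def)

lemma dyadic_cube_diff_negligible:
  assumes "l > 0"
  shows "negligible (dyadic_cube a l k x - dyadic a l k x)"
proof -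
  have "dyadic_cube a l k x - dyadic a l k x \<subseteq> dyadic_cube a l k x -
      box (dyadic_corner a l k x) (dyadic_corner a l k x + vec (l / 2 ^ k))"
    using box_subset_dyadic[OF assms] by blast
  then show ?thesis
    unfolding dyadic_cube_def using negligible_frontier_interval negligible_subset by blast
qed

lemma
  assumes "l > 0"
  shows dyadic_lmeasurable: "dyadic a l k x \<in> lmeasurable"
    and measure_dyadic_eq_cube: "measure lebesgue (dyadic a l k x) = measure lebesgue (dyadic_cube a l k x)"
proof -
  have "sym_diff (dyadic_cube a l k x) (dyadic a l k x) = dyadic_cube a l k x - dyadic a l k x"
    using dyadic_subset_dyadic_cube[OF assms, of a k x] by auto
  then have *: "negligible (sym_diff (dyadic_cube a l k x) (dyadic a l k x))"
    using dyadic_cube_diff_negligible[OF assms] by metis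
  show "dyadic a l k x \<in> lmeasurable"
    using is_cube_lmeasurable[OF is_cube_dyadic_cube[OF assms]] * by (rule lmeasurable_negligible_symdiff)
  show "measure lebesgue (dyadic a l k x) = measure lebesgue (dyadic_cube a l k x)"
    using is_cube_lmeasurable[OF is_cube_dyadic_cube[OF assms]] * by (rule measure_negligible_symdiff)
qed

lemma measure_dyadic:
  fixes a :: "real ^ 'n"
  assumes "l > 0"
  shows "measure lebesgue (dyadic a l k x) = (l / 2 ^ k) ^ CARD('n)"
  using assms measure_cube[of "l / 2 ^ k" "dyadic_corner a l k x"]
  by (simp add: measure_dyadic_eq_cube dyadic_cube_def)

text \<open>Nesting of the closed cubes is inherited from the half-open ones: the open box lies in
  the larger closed cube, and its closure is the smaller closed cube.\<close>

lemma dyadic_cube_antimono: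
  assumes "l > 0" "j \<le> k"
  shows "dyadic_cube a l k x \<subseteq> dyadic_cube a l j x"
proof -
  let ?B = "box (dyadic_corner a l k x) (dyadic_corner a l k x + vec (l / 2 ^ k))"
  have "?B \<subseteq> dyadic_cube a l j x"
    using box_subset_dyadic[OF assms(1)] dyadic_antimono[OF assms(2)] dyadic_subset_dyadic_cube[OF assms(1)]
    by blast
  moreover have "closed (dyadic_cube a l j x)" unfolding dyadic_cube_def by (rule closed_cbox)
  ultimately have "closure ?B \<subseteq> dyadic_cube a l j x"
    by (rule closure_minimal)
  moreover have "?B \<noteq> {}"
    using assms by (simp add: interval_ne_empty_cart)
  ultimately show ?thesis by (simp add: closure_box dyadic_cube_def)
qed

lemma dyadic_cube_eq: "dyadic a l k x = dyadic a l k y \<Longrightarrow> dyadic_cube a l k x = dyadic_cube a l k y"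
  using dyadic_self[of x a l k] by (simp add: dyadic_def dyadic_cube_def dyadic_corner_def)

lemma dyadic_small:
  fixes a :: "real ^ 'n"
  assumes "l > 0" "open V" "x \<in> V"
  shows "\<exists>k. dyadic a l k x \<subseteq> V"
proof -
  obtain e where e: "e > 0" "ball x e \<subseteq> V" using assms by (meson openE)
  have "(\<lambda>k. CARD('n) * (l / 2 ^ k)) \<longlonglongrightarrow> 0" by real_asymp
  then have "eventually (\<lambda>k. CARD('n) * (l / 2 ^ k) < e) sequentially"
    using e(1) by (simp add: order_tendstoD(2))
  then obtain k where k: "CARD('n) * (l / 2 ^ k) < e"
    by (auto simp: eventually_sequentially)
  have "dyadic a l k x \<subseteq> ball x e"
  proof
    fix y assume y: "y \<in> dyadic a l k x"
    have "\<bar>(x - y) $ i\<bar> \<le> l / 2 ^ k" for i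
      using y dyadic_self[of x a l k] unfolding dyadic_iff[OF assms(1)]
      by (smt (verit) vector_minus_component)
    then have "norm (x - y) \<le> (\<Sum>i\<in>(UNIV::'n set). l / 2 ^ k)"
      by (intro order_trans[OF norm_le_l1_cart] sum_mono) auto
    then show "y \<in> ball x e" using k by (simp add: dist_norm)
  qed
  with e show ?thesis by blast
qed

lemma countable_dyadic: "countable {dyadic a l k x |k x. True}"
proof -
  \<comment> \<open>A cube is determined by its generation and its vector of integer indices, and
    such pairs form a countable type.\<close>
  have "{dyadic a l k x |k x. True} \<subseteq>
     range (\<lambda>(k, m). {y. \<forall>i. \<lfloor>2 ^ k * ((y $ i - a $ i) / l)\<rfloor> = m i})"
    by (force simp: dyadic_def)
  then show ?thesis by (rule countable_subset) simp
qed

text \<open>Each point that ever satisfies \<open>P\<close> stops at its first such generation. By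
  \<open>compat\<close> the property belongs to the cube and not to the point, so the stopping
  generation is constant on the chosen cube; hence two chosen cubes that meet coincide.\<close>

lemma dyadic_stopping:
  assumes compat: "\<And>k x y. dyadic a l k x = dyadic a l k y \<Longrightarrow> P k x \<longleftrightarrow> P k y"
  obtains \<D> where "countable \<D>" "disjoint \<D>" "\<Union>\<D> = {x. \<exists>k. P k x}"
    "\<And>I. I \<in> \<D> \<Longrightarrow> \<exists>k x. I = dyadic a l k x \<and> P k x \<and> (\<forall>j<k. \<not> P j x)"
proof -
  define \<kappa> where "\<kappa> x = (LEAST k. P k x)" for x
  define S where "S = {x. \<exists>k. P k x}"
  define \<D> where "\<D> = (\<lambda>x. dyadic a l (\<kappa> x) x) ` S"
  have P\<kappa>: "P (\<kappa> x) x" if "x \<in> S" for x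
    using that unfolding S_def \<kappa>_def by (auto intro: LeastI)
  have min: "\<not> P j x" if "j < \<kappa> x" for x j
    using that unfolding \<kappa>_def by (rule not_less_Least)
  have same: "dyadic a l j y = dyadic a l j x" if "y \<in> dyadic a l (\<kappa> x) x" "j \<le> \<kappa> x" for x y j
    using that dyadic_antimono dyadic_eq by blast
  have stop: "P (\<kappa> x) y" if "x \<in> S" "y \<in> dyadic a l (\<kappa> x) x" for x y
    using P\<kappa>[OF that(1)] compat[OF same[OF that(2) order_refl]] by simp
  have \<kappa>_eq: "\<kappa> y = \<kappa> x" if "x \<in> S" "y \<in> dyadic a l (\<kappa> x) x" for x y
  proof (rule antisym)
    show "\<kappa> y \<le> \<kappa> x"
      unfolding \<kappa>_def[of y] using stop[OF that] by (rule Least_le)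
    have "y \<in> S" using stop[OF that] by (auto simp: S_def)
    show "\<kappa> x \<le> \<kappa> y"
    proof (rule ccontr)
      assume "\<not> \<kappa> x \<le> \<kappa> y"
      then have "\<kappa> y < \<kappa> x" by simp
      \<comment> \<open>The cube of the coarser generation \<open>\<kappa> y\<close> contains both
        points, so \<open>x\<close> would have stopped there as well.\<close>
      then have "P (\<kappa> y) x" using P\<kappa>[OF \<open>y \<in> S\<close>] compat[OF same[OF that(2), of "\<kappa> y"]] by simp
      with min[OF \<open>\<kappa> y < \<kappa> x\<close>] show False ..
    qed
  qed
  show ?thesis
  proof
    show "countable \<D>"
      by (rule countable_subset[OF _ countable_dyadic[of a l]]) (auto simp: \<D>_def)
    show "disjoint \<D>"
    proof (rule disjointI)
      fix I K assume "I \<in> \<D>" "K \<in> \<D>" "I \<noteq> K"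
      then obtain x y where xy: "x \<in> S" "I = dyadic a l (\<kappa> x) x" "y \<in> S" "K = dyadic a l (\<kappa> y) y"
        by (auto simp: \<D>_def)
      show "I \<inter> K = {}"
      proof (rule ccontr)
        assume "I \<inter> K \<noteq> {}"
        then obtain z where "z \<in> I" "z \<in> K" by blast
        then have "\<kappa> x = \<kappa> y" "dyadic a l (\<kappa> x) z = I" "dyadic a l (\<kappa> y) z = K"
          using xy \<kappa>_eq[of x z] \<kappa>_eq[of y z] dyadic_eq[of z a l "\<kappa> x" x] dyadic_eq[of z a l "\<kappa> y" y]
          by (simp_all only:)
        then have "I = K" by simp
        with \<open>I \<noteq> K\<close> show False ..
      qed
    qed
    have "y \<in> S" if "x \<in> S" "y \<in> dyadic a l (\<kappa> x) x" for x y
      using stop[OF that] by (auto simp: S_def)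
    then show "\<Union>\<D> = {x. \<exists>k. P k x}"
      unfolding S_def[symmetric] using dyadic_self by (fastforce simp: \<D>_def)
    show "\<exists>k x. I = dyadic a l k x \<and> P k x \<and> (\<forall>j<k. \<not> P j x)" if "I \<in> \<D>" for I
      using that P\<kappa> min unfolding \<D>_def by blast
  qed
qed

section \<open>Density and covering estimates for stopping cubes\<close>

text \<open>Bounds on single cubes add up by countable additivity. With \<open>A\<close> or
  \<open>B\<close> equal to \<open>UNIV\<close> this compares a set with the total measure of the
  cubes, in either direction.\<close>

lemma emeasure_Int_Union_le:
  assumes "countable \<D>" "disjoint \<D>" "\<D> \<subseteq> sets M" "A \<in> sets M" "B \<in> sets M"
    and le: "\<And>I. I \<in> \<D> \<Longrightarrow> emeasure M (A \<inter> I) \<le> c * emeasure M (B \<inter> I)"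
  shows "emeasure M (A \<inter> \<Union>\<D>) \<le> c * emeasure M (B \<inter> \<Union>\<D>)"
proof -
  have *: "emeasure M (A \<inter> \<Union>\<D>) = (\<integral>\<^sup>+I. emeasure M (A \<inter> I) \<partial>count_space \<D>)" if "A \<in> sets M" for A
  proof -
    have "disjoint_family_on ((\<inter>) A) \<D>"
      using assms(2) by (auto simp: disjoint_family_on_def disjoint_def)
    then have "emeasure M (\<Union>I\<in>\<D>. A \<inter> I) = (\<integral>\<^sup>+I. emeasure M (A \<inter> I) \<partial>count_space \<D>)"
      using assms(1,3) that by (intro emeasure_UN_countable) auto
    moreover have "A \<inter> \<Union>\<D> = (\<Union>I\<in>\<D>. A \<inter> I)" by blast
    ultimately show ?thesis by (simp only:)
  qed
  have "emeasure M (A \<inter> \<Union>\<D>) \<le> (\<integral>\<^sup>+I. c * emeasure M (B \<inter> I) \<partial>count_space \<D>)"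
    unfolding *[OF assms(4)] using le by (intro nn_integral_mono) auto
  also have "\<dots> = c * emeasure M (B \<inter> \<Union>\<D>)"
    unfolding *[OF assms(5)] by (rule nn_integral_cmult) simp
  finally show ?thesis .
qed

text \<open>A substitute for the Lebesgue density theorem: cover \<open>F\<close> by disjoint dyadic cubes inside an open
  set of almost the same measure.\<close>

lemma null_outside_stopping:
  fixes a :: "real ^ 'n"
  assumes l: "l > 0" and E: "E \<in> lmeasurable" and \<alpha>: "0 < \<alpha>" "\<alpha> < 1"
    and F: "F \<in> sets lebesgue" "F \<subseteq> E"
    and sparse: "\<And>k x. x \<in> F \<Longrightarrow> measure lebesgue (E \<inter> dyadic a l k x) \<le> \<alpha> * measure lebesgue (dyadic a l k x)"
  shows "F \<in> null_sets lebesgue"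
proof (rule ccontr)
  assume nonnull: "F \<notin> null_sets lebesgue"
  have Fm: "F \<in> lmeasurable" using F E fmeasurableI2 by blast
  define f where "f = measure lebesgue F"
  have f: "f > 0"
    using nonnull F(1) emeasure_eq_measure2[OF Fm] unfolding f_def
    by (metis ennreal_0 measure_nonneg null_setsI order_le_less)
  \<comment> \<open>This \<open>d\<close> solves \<open>\<alpha> * (d + f) = f\<close>, so an open
    superset \<open>V\<close> of \<open>F\<close> with excess less than \<open>d\<close> satisfies
    \<open>\<alpha> * measure lebesgue V < f\<close>.\<close>
  define d where "d = (1 - \<alpha>) / \<alpha> * f"
  have "d > 0" using f \<alpha> by (simp add: d_def)
  then obtain V where V: "open V" "F \<subseteq> V" "V - F \<in> lmeasurable" "emeasure lebesgue (V - F) < ennreal d"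
    using sets_lebesgue_outer_open[OF F(1)] by blast
  have Vm: "V \<in> lmeasurable"
    using fmeasurable.Un[OF V(3) Fm] V(2) by (metis Diff_partition Un_commute)
  have "measure lebesgue V = measure lebesgue (V - F) + f"
    unfolding f_def using measure_Un2[OF Fm Vm] V(2) by (simp add: Un_absorb1)
  moreover have "measure lebesgue (V - F) < d"
    using V(3,4) \<open>d > 0\<close> by (simp add: emeasure_eq_measure2 ennreal_less_iff)
  ultimately have "\<alpha> * measure lebesgue V < \<alpha> * (d + f)"
    using \<alpha> by simp
  also have "\<dots> = f" using \<alpha> by (simp add: d_def field_simps)
  finally have less: "\<alpha> * measure lebesgue V < f" .
  obtain \<D> where \<D>: "countable \<D>" "disjoint \<D>"
    "\<Union>\<D> = {x. \<exists>k. dyadic a l k x \<subseteq> V \<and> dyadic a l k x \<inter> F \<noteq> {}}"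
    "\<And>I. I \<in> \<D> \<Longrightarrow> \<exists>k x. I = dyadic a l k x \<and> (dyadic a l k x \<subseteq> V \<and> dyadic a l k x \<inter> F \<noteq> {}) \<and>
        (\<forall>j<k. \<not> (dyadic a l j x \<subseteq> V \<and> dyadic a l j x \<inter> F \<noteq> {}))"
    by (rule dyadic_stopping[of a l "\<lambda>k x. dyadic a l k x \<subseteq> V \<and> dyadic a l k x \<inter> F \<noteq> {}"]) (simp, blast)
  have ms: "\<D> \<subseteq> sets lebesgue"
  proof
    fix I assume "I \<in> \<D>"
    then obtain k x where "I = dyadic a l k x" using \<D>(4) by blast
    then show "I \<in> sets lebesgue" using fmeasurableD[OF dyadic_lmeasurable[OF l]] by simp
  qed
  have UV: "\<Union>\<D> \<subseteq> V" unfolding \<D>(3) using dyadic_self by blast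
  have FU: "F \<subseteq> \<Union>\<D>"
  proof
    fix x assume "x \<in> F"
    then obtain k where "dyadic a l k x \<subseteq> V" using dyadic_small[OF l V(1)] V(2) by blast
    then show "x \<in> \<Union>\<D>" unfolding \<D>(3) using \<open>x \<in> F\<close> dyadic_self by blast
  qed
  have Es: "E \<in> sets lebesgue" using E by blast
  have Us: "\<Union>\<D> \<in> sets lebesgue" using \<D>(1) ms by (metis sets.countable_Union)
  \<comment> \<open>Every chosen cube contains a point of \<open>F\<close>, at which
    \<open>sparse\<close> bounds the share of \<open>E\<close>. The sum is below \<open>f\<close>,
    although \<open>E \<inter> \<Union>\<D>\<close> contains \<open>F\<close>.\<close>
  have "emeasure lebesgue (E \<inter> \<Union>\<D>) \<le> ennreal \<alpha> * emeasure lebesgue (UNIV \<inter> \<Union>\<D>)"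
  proof (rule emeasure_Int_Union_le[OF \<D>(1,2) ms Es])
    fix I assume "I \<in> \<D>"
    then obtain k x y where I: "I = dyadic a l k x" "y \<in> I" "y \<in> F" using \<D>(4) by blast
    then have "dyadic a l k y = I" using dyadic_eq by blast
    then have le: "measure lebesgue (E \<inter> I) \<le> \<alpha> * measure lebesgue I" using sparse[OF I(3), of k] by simp
    have Im: "I \<in> lmeasurable" unfolding I(1) by (rule dyadic_lmeasurable[OF l])
    have "E \<inter> I \<in> lmeasurable" using E Im by blast
    then show "emeasure lebesgue (E \<inter> I) \<le> ennreal \<alpha> * emeasure lebesgue (UNIV \<inter> I)"
      using le Im \<alpha> by (simp add: emeasure_eq_measure2 flip: ennreal_mult)
  qed simp
  also have "\<dots> \<le> ennreal \<alpha> * emeasure lebesgue V"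
    using UV Vm by (intro mult_left_mono emeasure_mono) auto
  also have "\<dots> = ennreal (\<alpha> * measure lebesgue V)"
    using Vm \<alpha> by (simp add: emeasure_eq_measure2 ennreal_mult)
  also have "\<dots> < ennreal f"
    using less f by (simp add: ennreal_lessI)
  also have "ennreal f = emeasure lebesgue F" using Fm by (simp add: f_def emeasure_eq_measure2)
  also have "\<dots> \<le> emeasure lebesgue (E \<inter> \<Union>\<D>)"
    using F(2) FU Es Us by (intro emeasure_mono) auto
  finally show False by simp
qed

text \<open>Stop at the first cube in which \<open>E\<close> has density above \<alpha>. The parent
  was not stopped, which bounds the density in the chosen cube by
  \<open>2 ^ CARD('n) * \<alpha>\<close>; the stopping condition itself bounds the total measure;
  points that never stop see only low density, so \<open>null_outside_stopping\<close> applies to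
  them.\<close>

lemma calderon_zygmund:
  fixes a :: "real ^ 'n"
  assumes l: "l > 0" and E: "E \<in> lmeasurable" "E \<subseteq> dyadic a l 0 a" and \<alpha>: "0 < \<alpha>" "\<alpha> < 1"
    and small: "measure lebesgue E < \<alpha> * l ^ CARD('n)"
  obtains \<D> where "countable \<D>" "disjoint \<D>"
    "\<And>I. I \<in> \<D> \<Longrightarrow> \<exists>k x. I = dyadic a l k x \<and> dyadic a l 0 x = dyadic a l 0 a \<and>
       measure lebesgue (E \<inter> I) \<le> 2 ^ CARD('n) * \<alpha> * measure lebesgue I"
    "emeasure lebesgue (\<Union>\<D>) \<le> ennreal (1 / \<alpha>) * emeasure lebesgue E"
    "E - \<Union>\<D> \<in> null_sets lebesgue"
proof -
  let ?P = "\<lambda>k x. \<alpha> * measure lebesgue (dyadic a l k x) < measure lebesgue (E \<inter> dyadic a l k x)"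
  obtain \<D> where \<D>: "countable \<D>" "disjoint \<D>" "\<Union>\<D> = {x. \<exists>k. ?P k x}"
    "\<And>I. I \<in> \<D> \<Longrightarrow> \<exists>k x. I = dyadic a l k x \<and> ?P k x \<and> (\<forall>j<k. \<not> ?P j x)"
    by (rule dyadic_stopping[of a l ?P]) (simp, blast)
  have Es: "E \<in> sets lebesgue" using E by blast
  have ms: "\<D> \<subseteq> sets lebesgue"
  proof
    fix I assume "I \<in> \<D>"
    then obtain k x where "I = dyadic a l k x" using \<D>(4) by blast
    then show "I \<in> sets lebesgue" using fmeasurableD[OF dyadic_lmeasurable[OF l]] by simp
  qed
  have Us: "\<Union>\<D> \<in> sets lebesgue" using \<D>(1) ms by (metis sets.countable_Union)
  have Ed: "E \<inter> dyadic a l k x \<in> lmeasurable" for k x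
    using E(1) dyadic_lmeasurable[OF l, of a k x] by blast
  show ?thesis
  proof
    fix I assume "I \<in> \<D>"
    then obtain k x where I: "I = dyadic a l k x" "?P k x" "\<And>j. j < k \<Longrightarrow> \<not> ?P j x"
      using \<D>(4) by blast
    \<comment> \<open>The grid covers the whole space. A chosen cube meets \<open>E\<close>, which
      lies in the root cube, so the chosen cube descends from the root.\<close>
    have "E \<inter> I \<noteq> {}"
    proof
      assume "E \<inter> I = {}"
      then show False using I(1,2) \<alpha> by (simp add: measure_dyadic l mult_less_0_iff less_le_not_le l)
    qed
    then obtain z where "z \<in> E" "z \<in> dyadic a l k x" using I by blast
    then have "z \<in> dyadic a l 0 a" "z \<in> dyadic a l 0 x" using E dyadic_antimono[of 0 k] by blast+
    then have root: "dyadic a l 0 x = dyadic a l 0 a" using dyadic_eq by blast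
    \<comment> \<open>By \<open>small\<close> the root is not stopped, so every chosen cube has a
      parent, of generation \<open>j\<close>.\<close>
    have "\<not> ?P 0 x"
    proof -
      have "measure lebesgue (E \<inter> dyadic a l 0 x) \<le> measure lebesgue E"
        using E Ed by (intro measure_mono_fmeasurable) auto
      then show ?thesis using small l by (simp add: measure_dyadic)
    qed
    then obtain j where j: "k = Suc j" using I(2) by (cases k) auto
    have "measure lebesgue (E \<inter> I) \<le> measure lebesgue (E \<inter> dyadic a l j x)"
      using dyadic_antimono[of j k a l x] Ed[of k x] Ed[of j x] by (intro measure_mono_fmeasurable) (auto simp: I j)
    also have "\<dots> \<le> \<alpha> * measure lebesgue (dyadic a l j x)" using I(3)[of j] j by simp
    also have "\<dots> = 2 ^ CARD('n) * \<alpha> * measure lebesgue I"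
      using l by (simp add: I j measure_dyadic power_divide power_mult_distrib)
    finally show "\<exists>k x. I = dyadic a l k x \<and> dyadic a l 0 x = dyadic a l 0 a \<and>
       measure lebesgue (E \<inter> I) \<le> 2 ^ CARD('n) * \<alpha> * measure lebesgue I"
      using root I(1) by blast
  next
    have "emeasure lebesgue (UNIV \<inter> \<Union>\<D>) \<le> ennreal (1 / \<alpha>) * emeasure lebesgue (E \<inter> \<Union>\<D>)"
    proof (rule emeasure_Int_Union_le[OF \<D>(1,2) ms _ Es])
      fix I assume "I \<in> \<D>"
      then obtain k x where I: "I = dyadic a l k x" "?P k x"
        using \<D>(4) by blast
      have "measure lebesgue I \<le> (1 / \<alpha>) * measure lebesgue (E \<inter> I)"
        using I \<alpha> by (simp add: field_simps)
      then show "emeasure lebesgue (UNIV \<inter> I) \<le> ennreal (1 / \<alpha>) * emeasure lebesgue (E \<inter> I)"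
        unfolding I(1) using dyadic_lmeasurable[OF l, of a k x] Ed[of k x] \<alpha>
        by (simp add: emeasure_eq_measure2 ennreal_leI flip: ennreal_mult)
    qed simp
    also have "\<dots> \<le> ennreal (1 / \<alpha>) * emeasure lebesgue E"
      using Es by (intro mult_left_mono emeasure_mono) auto
    finally show "emeasure lebesgue (\<Union>\<D>) \<le> ennreal (1 / \<alpha>) * emeasure lebesgue E" by simp
  next
    show "E - \<Union>\<D> \<in> null_sets lebesgue"
    proof (rule null_outside_stopping[OF l E(1) \<alpha>])
      show "E - \<Union>\<D> \<in> sets lebesgue" using Es Us by blast
      show "measure lebesgue (E \<inter> dyadic a l k x) \<le> \<alpha> * measure lebesgue (dyadic a l k x)"
        if "x \<in> E - \<Union>\<D>" for k x
        using that unfolding \<D>(3) by (simp add: not_less)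
    qed blast
  qed (use \<D> in auto)
qed

section \<open>Exponential decay of the oscillation\<close>

text \<open>John--Nirenberg iteration, from a weak bound at one level \<open>r\<close> and for
  arbitrary centres \<open>m J\<close>. Decompose the set where the deviation on \<open>J\<close>
  exceeds \<open>r\<close>: on each stopping cube the centre moves by at most \<open>2 * r\<close>,
  so level \<open>2 * k + 3\<close> for \<open>J\<close> implies level \<open>2 * k + 1\<close> for
  that cube, where the induction hypothesis applies. The stopping cubes fill at most half of
  \<open>J\<close>, which gives the extra factor 1/2.\<close>

lemma oscillation_decay:
  fixes Q :: "(real ^ 'n) set" and m :: "(real ^ 'n) set \<Rightarrow> real"
  assumes meas[measurable]: "\<phi> \<in> borel_measurable lebesgue"
    and weak: "\<And>J. J \<in> subcubes Q \<Longrightarrow>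
      measure lebesgue {x\<in>J. r < \<bar>\<phi> x - m J\<bar>} \<le> measure lebesgue J / (4 * 2 ^ CARD('n))"
    and J: "J \<in> subcubes Q"
  shows "measure lebesgue {x\<in>J. (2 * real k + 1) * r < \<bar>\<phi> x - m J\<bar>} \<le> measure lebesgue J / 2 ^ k"
  using J
proof (induction k arbitrary: J)
  case 0
  have "1 \<le> 4 * (2::real) ^ CARD('n)"
    using one_le_power[of "2::real" "CARD('n)"] by linarith
  then have "measure lebesgue J / (4 * 2 ^ CARD('n)) \<le> measure lebesgue J"
    by (simp add: divide_le_eq mult_le_cancel_left1)
  then show ?case using weak[OF 0] by simp
next
  case (Suc k)
  define N where "N = (2::real) ^ CARD('n)"
  have N: "N \<ge> 2" unfolding N_def using power_increasing[of 1 "CARD('n)" "2::real"] by (simp add: Suc_leI)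
  \<comment> \<open>With this \<alpha> the set \<open>E\<close> fills at most half of each stopping
    cube, and \<open>|E| \<le> |J| / (4 * N)\<close> makes their total measure at most
    \<open>|J| / 2\<close>.\<close>
  define \<alpha> where "\<alpha> = 1 / (2 * N)"
  have \<alpha>: "0 < \<alpha>" "\<alpha> < 1" using N by (auto simp: \<alpha>_def)
  obtain a l where l: "0 < l" and Jal: "J = cbox a (a + vec l)"
    using Suc.prems by (auto simp: subcubes_def is_cube_def)
  have Jr: "J = dyadic_cube a l 0 a" using dyadic_cube_root[OF l, of a] Jal by simp
  have mJ: "measure lebesgue J = l ^ CARD('n)" unfolding Jal by (rule measure_cube[OF l])
  have lvl: "{x. c < \<bar>\<phi> x - d\<bar>} \<in> sets lebesgue" for c d
  proof -
    have "{x \<in> space lebesgue. c < \<bar>\<phi> x - d\<bar>} \<in> sets lebesgue" by measurable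
    then show ?thesis by simp
  qed
  have lvlK: "{x\<in>K. c < \<bar>\<phi> x - d\<bar>} \<in> lmeasurable" if "K \<in> lmeasurable" for K c d
    using fmeasurable_Int_fmeasurable[OF that lvl[of c d]] by (simp add: Collect_conj_eq)
  let ?R = "dyadic a l 0 a"
  have Rm: "?R \<in> lmeasurable" by (rule dyadic_lmeasurable[OF l])
  have RJ: "?R \<subseteq> J" unfolding Jr by (rule dyadic_subset_dyadic_cube[OF l])
  have Jm: "J \<in> lmeasurable" using Suc.prems by (simp add: subcubes_def is_cube_lmeasurable)
  define E where "E = {x\<in>?R. r < \<bar>\<phi> x - m J\<bar>}"
  have E: "E \<in> lmeasurable" "E \<subseteq> ?R" using lvlK[OF Rm] by (auto simp: E_def)
  have "measure lebesgue E \<le> measure lebesgue {x\<in>J. r < \<bar>\<phi> x - m J\<bar>}"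
    using E lvlK[OF Jm] RJ by (intro measure_mono_fmeasurable) (auto simp: E_def)
  also have "\<dots> \<le> l ^ CARD('n) / (4 * N)" using weak[OF Suc.prems] by (simp add: mJ N_def)
  finally have Ele: "measure lebesgue E \<le> l ^ CARD('n) / (4 * N)" .
  also have "\<dots> < \<alpha> * l ^ CARD('n)" using N l by (simp add: \<alpha>_def field_simps)
  finally have small: "measure lebesgue E < \<alpha> * l ^ CARD('n)" .
  obtain \<D> where \<D>: "countable \<D>" "disjoint \<D>"
    "\<And>I. I \<in> \<D> \<Longrightarrow> \<exists>k x. I = dyadic a l k x \<and> dyadic a l 0 x = dyadic a l 0 a \<and>
       measure lebesgue (E \<inter> I) \<le> 2 ^ CARD('n) * \<alpha> * measure lebesgue I"
    "emeasure lebesgue (\<Union>\<D>) \<le> ennreal (1 / \<alpha>) * emeasure lebesgue E"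
    "E - \<Union>\<D> \<in> null_sets lebesgue"
    using calderon_zygmund[OF l E \<alpha> small] by metis
  have ms: "\<D> \<subseteq> sets lebesgue"
  proof
    fix I assume "I \<in> \<D>"
    then obtain k x where "I = dyadic a l k x" using \<D>(3) by blast
    then show "I \<in> sets lebesgue" using fmeasurableD[OF dyadic_lmeasurable[OF l]] by simp
  qed
  have Us: "\<Union>\<D> \<in> sets lebesgue" using \<D>(1) ms by (metis sets.countable_Union)
  define G where "G = {x\<in>?R. (2 * real (Suc k) + 1) * r < \<bar>\<phi> x - m J\<bar>}"
  have G: "G \<in> lmeasurable" using lvlK[OF Rm] by (simp add: G_def)
  have step: "emeasure lebesgue (G \<inter> I) \<le> ennreal (1 / 2 ^ k) * emeasure lebesgue (UNIV \<inter> I)" if "I \<in> \<D>" for I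
  proof -
    from \<D>(3)[OF that] obtain j x where I: "I = dyadic a l j x" "dyadic a l 0 x = dyadic a l 0 a"
       "measure lebesgue (E \<inter> I) \<le> 2 ^ CARD('n) * \<alpha> * measure lebesgue I" by blast
    define K where "K = dyadic_cube a l j x"
    have "K \<subseteq> J"
      unfolding K_def Jr using dyadic_cube_antimono[OF l, of 0 j a x] dyadic_cube_eq[OF I(2)] by simp
    then have K: "K \<in> subcubes Q"
      using is_cube_dyadic_cube[OF l] Suc.prems by (auto simp: subcubes_def K_def)
    have Km: "K \<in> lmeasurable" unfolding K_def by (intro is_cube_lmeasurable is_cube_dyadic_cube l)
    have Im: "I \<in> lmeasurable" unfolding I(1) by (rule dyadic_lmeasurable[OF l])
    have IK: "I \<subseteq> K" unfolding I(1) K_def by (rule dyadic_subset_dyadic_cube[OF l])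
    have IR: "I \<subseteq> ?R" unfolding I(1) I(2)[symmetric] by (simp add: dyadic_antimono)
    have mIK: "measure lebesgue K = measure lebesgue I"
      unfolding I(1) K_def by (rule measure_dyadic_eq_cube[OF l, symmetric])
    have mI: "0 < measure lebesgue I" using l by (simp add: I(1) measure_dyadic)
    let ?B = "{y\<in>K. r < \<bar>\<phi> y - m K\<bar>}"
    \<comment> \<open>The two exceptional sets take shares of at most 1/2 and
      \<open>1 / (4 * N)\<close> of \<open>I\<close>, less than 1 together. A point outside both is
      within \<open>r\<close> of both centres.\<close>
    have "\<exists>y\<in>I. y \<notin> E \<and> y \<notin> ?B"
    proof (rule ccontr)
      assume "\<not> ?thesis"
      then have "I \<subseteq> (E \<inter> I) \<union> ?B" by blast
      moreover have "E \<inter> I \<in> lmeasurable" "?B \<in> lmeasurable" using E(1) Im lvlK[OF Km] by blast+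
      ultimately have "measure lebesgue I \<le> measure lebesgue (E \<inter> I) + measure lebesgue ?B"
        using measure_mono_fmeasurable[of I "(E \<inter> I) \<union> ?B" lebesgue] measure_Un_le[of "E \<inter> I" lebesgue ?B] Im
        by (meson fmeasurable.Un fmeasurableD order_trans)
      also have "\<dots> \<le> measure lebesgue I / 2 + measure lebesgue I / (4 * N)"
        using I(3) weak[OF K] N unfolding mIK by (simp add: \<alpha>_def N_def[symmetric])
      also have "\<dots> < measure lebesgue I"
        using mI N by (simp add: field_simps)
      finally show False by simp
    qed
    then obtain y where y: "y \<in> I" "y \<notin> E" "y \<notin> ?B" by blast
    then have mm: "\<bar>m K - m J\<bar> \<le> 2 * r" using IR IK by (auto simp: E_def)
    have "G \<inter> I \<subseteq> {z\<in>K. (2 * real k + 1) * r < \<bar>\<phi> z - m K\<bar>}"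
    proof
      fix z assume z: "z \<in> G \<inter> I"
      then have "(2 * real k + 1) * r + 2 * r < \<bar>\<phi> z - m J\<bar>" by (simp add: G_def algebra_simps)
      then show "z \<in> {z\<in>K. (2 * real k + 1) * r < \<bar>\<phi> z - m K\<bar>}" using mm z IK by auto
    qed
    then have "measure lebesgue (G \<inter> I) \<le> measure lebesgue {z\<in>K. (2 * real k + 1) * r < \<bar>\<phi> z - m K\<bar>}"
      using G Im lvlK[OF Km] by (intro measure_mono_fmeasurable) auto
    also have "\<dots> \<le> measure lebesgue I / 2 ^ k" using Suc.IH[OF K] by (simp only: mIK)
    finally have "measure lebesgue (G \<inter> I) \<le> (1 / 2 ^ k) * measure lebesgue I" by simp
    moreover have "G \<inter> I \<in> lmeasurable" using G Im by blast
    ultimately show ?thesis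
      using Im by (simp add: emeasure_eq_measure2 ennreal_leI flip: ennreal_mult)
  qed
  have "emeasure lebesgue (G \<inter> \<Union>\<D>) \<le> ennreal (1 / 2 ^ k) * emeasure lebesgue (UNIV \<inter> \<Union>\<D>)"
    using G by (intro emeasure_Int_Union_le[OF \<D>(1,2) ms] step) auto
  also have "\<dots> \<le> ennreal (1 / 2 ^ k) * (ennreal (1 / \<alpha>) * emeasure lebesgue E)"
    using \<D>(4) by (intro mult_left_mono) auto
  also have "\<dots> = ennreal (1 / 2 ^ k * (1 / \<alpha> * measure lebesgue E))"
    using \<alpha> by (simp add: emeasure_eq_measure2[OF E(1)] flip: ennreal_mult)
  also have "\<dots> \<le> ennreal (1 / 2 ^ k * (1 / \<alpha> * (l ^ CARD('n) / (4 * N))))"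
    using Ele \<alpha> by (intro ennreal_leI mult_left_mono) auto
  also have "1 / 2 ^ k * (1 / \<alpha> * (l ^ CARD('n) / (4 * N))) = measure lebesgue J / 2 ^ Suc k"
    using N by (simp add: \<alpha>_def mJ)
  finally have GU: "emeasure lebesgue (G \<inter> \<Union>\<D>) \<le> ennreal (measure lebesgue J / 2 ^ Suc k)" .
  let ?H = "{x\<in>J. (2 * real (Suc k) + 1) * r < \<bar>\<phi> x - m J\<bar>}"
  have lam: "r \<le> (2 * real (Suc k) + 1) * r" if "0 \<le> r"
    using that by (simp add: algebra_simps)
  \<comment> \<open>For negative \<open>r\<close> the set in \<open>weak\<close> would be all of
    \<open>J\<close>, which has positive measure.\<close>
  have lam0: "0 \<le> r"
  proof (rule ccontr)
    assume "\<not> 0 \<le> r"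
    then have "{x\<in>J. r < \<bar>\<phi> x - m J\<bar>} = J" by auto
    then have "measure lebesgue J \<le> measure lebesgue J / (4 * N)" using weak[OF Suc.prems] by (simp add: N_def)
    moreover have "0 < measure lebesgue J" using l by (simp only: mJ) simp
    ultimately show False using N by (simp add: field_simps)
  qed
  have GE: "G \<subseteq> E" using lam[OF lam0] by (auto simp: G_def E_def)
  \<comment> \<open>Only part of the boundary of \<open>J\<close> and the uncovered part of
    \<open>E\<close> escape the estimate on the stopping cubes.\<close>
  have null: "(J - ?R) \<union> (E - \<Union>\<D>) \<in> null_sets lebesgue"
    using \<D>(5) dyadic_cube_diff_negligible[OF l, of a 0 a] unfolding Jr[symmetric]
    by (simp add: negligible_iff_null_sets null_sets.Un)
  have "?H \<subseteq> (G \<inter> \<Union>\<D>) \<union> ((J - ?R) \<union> (E - \<Union>\<D>))"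
    using GE by (auto simp: G_def)
  then have "emeasure lebesgue ?H \<le> emeasure lebesgue ((G \<inter> \<Union>\<D>) \<union> ((J - ?R) \<union> (E - \<Union>\<D>)))"
    using G Us null by (intro emeasure_mono) auto
  also have "\<dots> = emeasure lebesgue (G \<inter> \<Union>\<D>)"
    using G Us null by (intro emeasure_Un_null_set) auto
  finally have "emeasure lebesgue ?H \<le> ennreal (measure lebesgue J / 2 ^ Suc k)" using GU by simp
  then show ?case
    using lvlK[OF Jm] by (simp add: emeasure_eq_measure2 ennreal_le_iff)
qed

section \<open>Soft truncation\<close>

text \<open>Mean value theorem, combined with the fact that the derivative
  \<open>1 / (1 + z\<^sup>2)\<close> is 1-Lipschitz.\<close>

lemma arctan_Taylor:
  fixes x y :: real
  shows "\<bar>arctan x - arctan y - (x - y) / (1 + y\<^sup>2)\<bar> \<le> (x - y)\<^sup>2"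
proof -
  have lip: "\<bar>1 / (1 + z\<^sup>2) - 1 / (1 + y\<^sup>2)\<bar> \<le> \<bar>z - y\<bar>" for z :: real
  proof -
    have pos: "0 < (1 + z\<^sup>2) * (1 + y\<^sup>2)" by (intro mult_pos_pos add_pos_nonneg) auto
    \<comment> \<open>The derivatives at \<open>z\<close> and \<open>y\<close> differ by
      \<open>(y - z) * (z + y)\<close> over \<open>(1 + z\<^sup>2) * (1 + y\<^sup>2)\<close>; this
      bound lets the denominator absorb \<open>z + y\<close>.\<close>
    have "\<bar>y\<bar> + \<bar>z\<bar> \<le> (1 + y\<^sup>2) / 2 + (1 + z\<^sup>2) / 2"
    proof -
      have "2 * \<bar>t\<bar> \<le> 1 + t\<^sup>2" for t :: real
        using zero_le_power2[of "1 - \<bar>t\<bar>"] by (simp add: power2_diff)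
      from this[of y] this[of z] show ?thesis by (simp add: field_simps)
    qed
    also have "\<dots> \<le> (1 + z\<^sup>2) * (1 + y\<^sup>2)"
      using zero_le_power2[of y] zero_le_power2[of z] mult_nonneg_nonneg[OF zero_le_power2[of y] zero_le_power2[of z]]
      by (simp add: field_simps)
    finally have le: "\<bar>z + y\<bar> \<le> (1 + z\<^sup>2) * (1 + y\<^sup>2)" by linarith
    have "1 / (1 + z\<^sup>2) - 1 / (1 + y\<^sup>2) = (y - z) * (z + y) / ((1 + z\<^sup>2) * (1 + y\<^sup>2))"
    proof -
      have "1 + z\<^sup>2 \<noteq> 0" "1 + y\<^sup>2 \<noteq> 0" using pos by auto
      moreover have "(1 + y\<^sup>2) - (1 + z\<^sup>2) = (y - z) * (z + y)"
        by (simp add: power2_eq_square algebra_simps)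
      ultimately show ?thesis by (simp add: diff_frac_eq)
    qed
    then have "\<bar>1 / (1 + z\<^sup>2) - 1 / (1 + y\<^sup>2)\<bar> = \<bar>z - y\<bar> * (\<bar>z + y\<bar> / ((1 + z\<^sup>2) * (1 + y\<^sup>2)))"
      using pos by (simp add: abs_mult abs_minus_commute)
    also have "\<dots> \<le> \<bar>z - y\<bar> * 1"
      using le pos by (intro mult_left_mono) (simp_all add: divide_le_eq)
    finally show ?thesis by simp
  qed
  have mvt: "\<exists>z. \<bar>z - y\<bar> \<le> \<bar>x - y\<bar> \<and> arctan x - arctan y = (x - y) * (1 / (1 + z\<^sup>2))"
  proof -
    have d: "\<And>t. (arctan has_real_derivative 1 / (1 + t\<^sup>2)) (at t)"
      using DERIV_arctan by (simp add: inverse_eq_divide)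
    consider "x < y" | "x = y" | "y < x" by linarith
    then show ?thesis
    proof cases
      case 1
      then obtain z where "z > x" "z < y" "arctan y - arctan x = (y - x) * (1 / (1 + z\<^sup>2))"
        using MVT2[of x y arctan "\<lambda>t. 1 / (1 + t\<^sup>2)"] d by blast
      then show ?thesis by (intro exI[of _ z]) (auto simp: algebra_simps diff_divide_distrib)
    next
      case 3
      then obtain z where "z > y" "z < x" "arctan x - arctan y = (x - y) * (1 / (1 + z\<^sup>2))"
        using MVT2[of y x arctan "\<lambda>t. 1 / (1 + t\<^sup>2)"] d by blast
      then show ?thesis by (intro exI[of _ z]) auto
    qed auto
  qed
  then obtain z where z: "\<bar>z - y\<bar> \<le> \<bar>x - y\<bar>" "arctan x - arctan y = (x - y) * (1 / (1 + z\<^sup>2))" by blast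
  have "arctan x - arctan y - (x - y) / (1 + y\<^sup>2) = (x - y) * (1 / (1 + z\<^sup>2) - 1 / (1 + y\<^sup>2))"
    unfolding z(2) by (simp add: right_diff_distrib)
  then have "\<bar>arctan x - arctan y - (x - y) / (1 + y\<^sup>2)\<bar> = \<bar>x - y\<bar> * \<bar>1 / (1 + z\<^sup>2) - 1 / (1 + y\<^sup>2)\<bar>"
    by (simp add: abs_mult)
  also have "\<dots> \<le> \<bar>x - y\<bar> * \<bar>x - y\<bar>"
    using lip[of z] z(1) by (intro mult_left_mono) auto
  finally show ?thesis by (simp add: power2_eq_square flip: abs_mult)
qed

text \<open>For \<open>p < 1\<close> a sharp cut-off may increase the \<open>p\<close>-oscillation. The slope of \<open>soft_trunc N\<close> is at
  most 1 and varies by \<open>O(1/N)\<close> per unit length, so that on each cube the truncation is an affine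
  contraction up to a vanishing error.\<close>

definition soft_trunc :: "real \<Rightarrow> real \<Rightarrow> real" where
  "soft_trunc N t = N * arctan (t / N)"

lemma soft_trunc_measurable [measurable]: "soft_trunc N \<in> borel_measurable borel"
  unfolding soft_trunc_def by measurable

lemma soft_trunc_bounded:
  assumes "N > 0"
  shows "\<bar>soft_trunc N t\<bar> \<le> 2 * N"
proof -
  have "\<bar>arctan (t / N)\<bar> \<le> 2"
    using arctan_bounded[of "t / N"] pi_less_4 by linarith
  from mult_left_mono[OF this, of N] assms show ?thesis
    by (simp add: soft_trunc_def abs_mult mult.commute)
qed

text \<open>Rescaling of \<open>arctan_Taylor\<close>: the outer factor \<open>N\<close> against the
  squared inner factor \<open>1 / N\<close> leaves an error of order \<open>1 / N\<close>. The
  linear part has slope at most 1 for every base point \<open>m\<close>.\<close>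

lemma soft_trunc_Taylor:
  assumes "N > 0"
  shows "\<bar>soft_trunc N t - soft_trunc N m - (t - m) / (1 + (m / N)\<^sup>2)\<bar> \<le> (t - m)\<^sup>2 / N"
proof -
  have "\<bar>arctan (t / N) - arctan (m / N) - (t / N - m / N) / (1 + (m / N)\<^sup>2)\<bar> \<le> (t / N - m / N)\<^sup>2"
    by (rule arctan_Taylor)
  then have "N * \<bar>arctan (t / N) - arctan (m / N) - (t / N - m / N) / (1 + (m / N)\<^sup>2)\<bar> \<le> N * (t / N - m / N)\<^sup>2"
    using assms by (intro mult_left_mono) auto
  moreover have "N * \<bar>arctan (t / N) - arctan (m / N) - (t / N - m / N) / (1 + (m / N)\<^sup>2)\<bar> =
      \<bar>N * (arctan (t / N) - arctan (m / N) - (t / N - m / N) / (1 + (m / N)\<^sup>2))\<bar>"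
    using assms by (simp add: abs_mult)
  moreover have "N * (arctan (t / N) - arctan (m / N) - (t / N - m / N) / (1 + (m / N)\<^sup>2)) =
      soft_trunc N t - soft_trunc N m - (t - m) / (1 + (m / N)\<^sup>2)"
    using assms by (simp add: soft_trunc_def right_diff_distrib diff_divide_distrib)
  moreover have "N * (t / N - m / N)\<^sup>2 = (t - m)\<^sup>2 / N"
    using assms by (simp add: power2_eq_square flip: diff_divide_distrib)
  ultimately show ?thesis by simp
qed

lemma soft_trunc_tendsto: "(\<lambda>n. soft_trunc (real (Suc n)) t) \<longlonglongrightarrow> t"
proof -
  have "norm (soft_trunc (real (Suc n)) t - t) \<le> t\<^sup>2 / real (Suc n)" for n
    using soft_trunc_Taylor[of "real (Suc n)" t 0] by (simp add: soft_trunc_def)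
  then have "\<forall>\<^sub>F n in sequentially. norm (soft_trunc (real (Suc n)) t - t) \<le> t\<^sup>2 / real (Suc n)"
    by simp
  moreover have "(\<lambda>n. t\<^sup>2 / real (Suc n)) \<longlonglongrightarrow> 0" by real_asymp
  ultimately have "(\<lambda>n. soft_trunc (real (Suc n)) t - t) \<longlonglongrightarrow> 0"
    by (rule Lim_null_comparison)
  then show ?thesis by (simp add: LIM_zero_iff)
qed

lemma soft_trunc_abs_le:
  assumes "N > 0"
  shows "\<bar>soft_trunc N t\<bar> \<le> \<bar>t\<bar>"
proof -
  have "\<bar>arctan x\<bar> \<le> \<bar>x\<bar>" for x :: real
  proof (cases "x \<ge> 0")
    case True
    then show ?thesis using arctan_le_self[of x] by simp
  next
    case False
    then show ?thesis using arctan_le_self[of "- x"] by (simp add: arctan_minus)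
  qed
  from mult_left_mono[OF this[of "t / N"], of N] assms show ?thesis
    by (simp add: soft_trunc_def abs_mult)
qed

text \<open>Replaces Minkowski's inequality for all \<open>p > 0\<close>. Either \<open>b\<close> is
  at most \<open>h * a\<close>, or \<open>a\<close> is at most \<open>b / h\<close>. For small
  \<open>h\<close> the factor of the main term is close to 1.\<close>

lemma powr_add_le:
  fixes a b h p :: real
  assumes "0 \<le> a" "0 \<le> b" "0 < h" "0 < p"
  shows "(a + b) powr p \<le> (1 + h) powr p * a powr p + (1 + 1 / h) powr p * b powr p"
proof (cases "b \<le> h * a")
  case True
  then have "(a + b) powr p \<le> ((1 + h) * a) powr p"
    using assms by (intro powr_mono2) (auto simp: algebra_simps)
  also have "\<dots> = (1 + h) powr p * a powr p" using assms by (simp add: powr_mult)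
  finally show ?thesis using assms by (simp add: add_increasing2)
next
  case False
  then have "a + b \<le> (1 + 1 / h) * b" using assms by (simp add: field_simps)
  then have "(a + b) powr p \<le> ((1 + 1 / h) * b) powr p"
    using assms by (intro powr_mono2) auto
  also have "\<dots> = (1 + 1 / h) powr p * b powr p" using assms by (simp add: powr_mult)
  finally show ?thesis using assms by (simp add: add_increasing)
qed

text \<open>Around the mean of \<phi> over \<open>J\<close> the truncation is a contraction of the
  deviation plus a quadratic remainder over \<open>N\<close>. The remainder costs a multiple of
  \<open>N powr (-p)\<close>, uniformly in \<open>J\<close>, through the moments of orders 2 and
  \<open>2 * p\<close>; the gap between \<kappa>' and \<kappa> pays for it.\<close>

lemma soft_trunc_oscillation:
  fixes Q :: "(real ^ 'n) set"
  assumes Q: "is_cube Q" and p: "0 < p" and meas[measurable]: "\<phi> \<in> borel_measurable lebesgue"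
    and int: "integrable (cube_prob Q) \<phi>"
    and osc: "\<And>J. J \<in> subcubes Q \<Longrightarrow> nn_avg J (\<lambda>x. \<bar>\<phi> x - avg J \<phi>\<bar> powr p) \<le> ennreal \<kappa>'"
    and \<kappa>: "0 \<le> \<kappa>'" "\<kappa>' < \<kappa>"
    and M2: "\<And>J. J \<in> subcubes Q \<Longrightarrow> nn_avg J (\<lambda>x. \<bar>\<phi> x - avg J \<phi>\<bar> powr 2) \<le> ennreal M2" "0 \<le> M2"
    and M3: "\<And>J. J \<in> subcubes Q \<Longrightarrow> nn_avg J (\<lambda>x. \<bar>\<phi> x - avg J \<phi>\<bar> powr (2 * p)) \<le> ennreal M3" "0 \<le> M3"
  shows "eventually (\<lambda>n. \<forall>J\<in>subcubes Q. nn_avg J (\<lambda>x. \<bar>soft_trunc (real (Suc n)) (\<phi> x) -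
      avg J (\<lambda>x. soft_trunc (real (Suc n)) (\<phi> x))\<bar> powr p) \<le> ennreal \<kappa>) sequentially"
proof -
  have "((\<lambda>h. (1 + h) powr p * \<kappa>') \<longlongrightarrow> (1 + 0) powr p * \<kappa>') (at_right 0)"
    by (intro tendsto_intros) auto
  then have "eventually (\<lambda>h. (1 + h) powr p * \<kappa>' < \<kappa>) (at_right 0)"
    using \<kappa> by (intro order_tendstoD(2)) auto
  moreover have "eventually (\<lambda>h::real. h > 0) (at_right 0)" by (simp add: eventually_at_right_less)
  ultimately have "eventually (\<lambda>h. h > 0 \<and> (1 + h) powr p * \<kappa>' < \<kappa>) (at_right (0::real))"
    by eventually_elim auto
  then obtain h where h: "h > 0" "(1 + h) powr p * \<kappa>' < \<kappa>"
    using eventually_happens'[OF trivial_limit_at_right_real[of 0]] by blast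
  \<comment> \<open>Here \<open>c1\<close> and \<open>c2\<close> are the constants of
    \<open>powr_add_le\<close> for the chosen \<open>h\<close>, and \<open>c3\<close> is both of its
    constants for \<open>h = 1\<close>.\<close>
  define c1 where "c1 = (1 + h) powr p"
  define c2 where "c2 = (1 + 1 / h) powr p"
  define c3 where "c3 = (2::real) powr p"
  have c: "c1 \<ge> 0" "c2 \<ge> 0" "c3 \<ge> 0" by (auto simp: c1_def c2_def c3_def)
  have "((\<lambda>n. c1 * \<kappa>' + c2 * (real (Suc n) powr (-p)) * (c3 * M3 + c3 * M2 powr p)) \<longlongrightarrow>
     c1 * \<kappa>' + c2 * 0 * (c3 * M3 + c3 * M2 powr p)) sequentially"
    using p by (intro tendsto_intros) real_asymp
  then have "eventually (\<lambda>n. c1 * \<kappa>' + c2 * (real (Suc n) powr (-p)) * (c3 * M3 + c3 * M2 powr p) < \<kappa>) sequentially"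
    using h by (intro order_tendstoD(2)) (auto simp: c1_def)
  then show ?thesis
  proof eventually_elim
    case (elim n)
    define N where "N = real (Suc n)"
    have N: "N > 0" by (simp add: N_def)
    define d where "d = c2 * N powr (-p)"
    have d: "d \<ge> 0" using c by (simp add: d_def)
    show ?case unfolding N_def[symmetric]
    proof
      fix J assume J: "J \<in> subcubes Q"
      have cJ: "is_cube J" using J by (rule subcubes_is_cube)
      interpret prob_space "cube_prob J" by (rule prob_space_cube_prob[OF cJ])
      define m where "m = avg J \<phi>"
      define u where "u = (\<lambda>x. \<phi> x - m)"
      have [measurable]: "u \<in> borel_measurable lebesgue" by (simp add: u_def)
      have im: "integrable (cube_prob J) \<phi>" using integrable_subcube[OF Q J meas int] .
      have iT: "integrable (cube_prob J) (\<lambda>x. soft_trunc N (\<phi> x))"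
        using soft_trunc_bounded[OF N] by (intro integrable_const_bound[where B="2 * N"]) auto
      define s where "s = 1 + (m / N)\<^sup>2"
      have s: "s \<ge> 1" by (simp add: s_def)
      \<comment> \<open>The Taylor remainder at \<open>m\<close>, with \<open>1 / s\<close> the
        slope there.\<close>
      define r where "r = (\<lambda>x. soft_trunc N (\<phi> x) - soft_trunc N m - u x / s)"
      have r: "\<bar>r x\<bar> \<le> (u x)\<^sup>2 / N" for x
        using soft_trunc_Taylor[OF N, of "\<phi> x" m] by (simp add: r_def u_def s_def)
      have [measurable]: "r \<in> borel_measurable lebesgue" by (simp add: r_def)
      have ir: "integrable (cube_prob J) r" using im iT by (simp add: r_def u_def)
      have Eu: "(\<integral>x. u x \<partial>cube_prob J) = 0"
        using im cJ by (simp add: u_def m_def avg_cube_prob measure_cube_prob_UNIV)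
      have iu: "integrable (cube_prob J) u" using im by (simp add: u_def)
      \<comment> \<open>The linear term drops out because \<open>u\<close> has mean 0. Hence the
        deviation of the truncation from its own mean is \<open>u x / s\<close> plus the recentred
        remainder.\<close>
      have Er: "(\<integral>x. r x \<partial>cube_prob J) = avg J (\<lambda>x. soft_trunc N (\<phi> x)) - soft_trunc N m"
        using iu iT cJ Eu by (simp add: r_def avg_cube_prob measure_cube_prob_UNIV)
      have u2: "(\<integral>\<^sup>+x. ennreal ((u x)\<^sup>2) \<partial>cube_prob J) \<le> ennreal M2"
      proof -
        have "(\<lambda>x. \<bar>u x\<bar> powr 2) = (\<lambda>x. (u x)\<^sup>2)"
          by (simp add: fun_eq_iff powr_numeral)
        then show ?thesis using M2(1)[OF J] cJ by (simp add: nn_avg_cube_prob u_def flip: m_def)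
      qed
      have "ennreal \<bar>\<integral>x. r x \<partial>cube_prob J\<bar> \<le> (\<integral>\<^sup>+x. ennreal \<bar>r x\<bar> \<partial>cube_prob J)"
        using integral_norm_bound_ennreal[OF ir] by simp
      also have "\<dots> \<le> (\<integral>\<^sup>+x. ennreal (1 / N) * ennreal ((u x)\<^sup>2) \<partial>cube_prob J)"
        using r N by (intro nn_integral_mono) (simp add: ennreal_leI flip: ennreal_mult)
      also have "\<dots> = ennreal (1 / N) * (\<integral>\<^sup>+x. ennreal ((u x)\<^sup>2) \<partial>cube_prob J)"
        by (rule nn_integral_cmult) measurable
      also have "\<dots> \<le> ennreal (1 / N) * ennreal M2" using u2 by (rule mult_left_mono) simp
      also have "\<dots> = ennreal (M2 / N)" using N M2(2) by (simp flip: ennreal_mult)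
      finally have Er_le: "\<bar>\<integral>x. r x \<partial>cube_prob J\<bar> \<le> M2 / N" using N M2(2) by simp
      have pw: "\<bar>soft_trunc N (\<phi> x) - avg J (\<lambda>x. soft_trunc N (\<phi> x))\<bar> powr p \<le>
          c1 * \<bar>u x\<bar> powr p + d * c3 * \<bar>u x\<bar> powr (2 * p) + d * c3 * M2 powr p" for x
      proof -
        have "soft_trunc N (\<phi> x) - avg J (\<lambda>x. soft_trunc N (\<phi> x)) = u x / s + (r x - (\<integral>x. r x \<partial>cube_prob J))"
          unfolding Er by (simp add: r_def)
        moreover have "\<bar>u x / s\<bar> \<le> \<bar>u x\<bar>" using s by (simp add: divide_le_eq mult_le_cancel_left1)
        ultimately have "\<bar>soft_trunc N (\<phi> x) - avg J (\<lambda>x. soft_trunc N (\<phi> x))\<bar> \<le> \<bar>u x\<bar> + ((u x)\<^sup>2 + M2) / N"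
          using r[of x] Er_le unfolding add_divide_distrib by linarith
        then have "\<bar>soft_trunc N (\<phi> x) - avg J (\<lambda>x. soft_trunc N (\<phi> x))\<bar> powr p \<le> (\<bar>u x\<bar> + ((u x)\<^sup>2 + M2) / N) powr p"
          using p by (intro powr_mono2) auto
        also have "\<dots> \<le> c1 * \<bar>u x\<bar> powr p + c2 * (((u x)\<^sup>2 + M2) / N) powr p"
          unfolding c1_def c2_def using N M2(2) h p by (intro powr_add_le) auto
        also have "(((u x)\<^sup>2 + M2) / N) powr p = N powr (-p) * ((u x)\<^sup>2 + M2) powr p"
          using N M2(2) by (simp add: powr_divide powr_minus field_simps)
        also have "c2 * (N powr (-p) * ((u x)\<^sup>2 + M2) powr p) \<le>
            d * (c3 * ((u x)\<^sup>2) powr p + c3 * M2 powr p)"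
          unfolding d_def mult.assoc[symmetric]
          using powr_add_le[of "(u x)\<^sup>2" M2 1 p] M2(2) p d unfolding d_def c3_def
          by (metis (no_types, lifting) distrib_left mult.assoc mult_left_mono one_add_one div_by_1 zero_le_power2 zero_less_one)
        also have "((u x)\<^sup>2) powr p = \<bar>u x\<bar> powr (2 * p)"
          by (metis abs_ge_zero power2_abs powr_numeral powr_powr)
        finally show ?thesis by (simp add: algebra_simps)
      qed
      let ?I = "\<lambda>f. \<integral>\<^sup>+x. f x \<partial>cube_prob J"
      have "nn_avg J (\<lambda>x. \<bar>soft_trunc N (\<phi> x) - avg J (\<lambda>x. soft_trunc N (\<phi> x))\<bar> powr p) \<le>
         ?I (\<lambda>x. ennreal (c1 * \<bar>u x\<bar> powr p + d * c3 * \<bar>u x\<bar> powr (2 * p) + d * c3 * M2 powr p))"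
        using pw cJ by (subst nn_avg_cube_prob) (auto intro!: nn_integral_mono ennreal_leI)
      also have "\<dots> = ?I (\<lambda>x. ennreal c1 * ennreal (\<bar>u x\<bar> powr p) +
          ennreal (d * c3) * ennreal (\<bar>u x\<bar> powr (2 * p)) + ennreal (d * c3 * M2 powr p))"
        using c d by (intro nn_integral_cong) (simp add: ennreal_plus flip: ennreal_mult)
      also have "\<dots> = ennreal c1 * ?I (\<lambda>x. ennreal (\<bar>u x\<bar> powr p)) +
          ennreal (d * c3) * ?I (\<lambda>x. ennreal (\<bar>u x\<bar> powr (2 * p))) + ennreal (d * c3 * M2 powr p)"
        using emeasure_space_1 by (simp add: nn_integral_add nn_integral_cmult)
      also have "\<dots> \<le> ennreal c1 * ennreal \<kappa>' + ennreal (d * c3) * ennreal M3 + ennreal (d * c3 * M2 powr p)"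
        using osc[OF J] M3(1)[OF J] cJ
        by (intro add_mono mult_left_mono) (auto simp: nn_avg_cube_prob u_def simp flip: m_def)
      also have "\<dots> = ennreal (c1 * \<kappa>' + d * (c3 * M3 + c3 * M2 powr p))"
        using c d \<kappa> M3(2) by (simp add: algebra_simps flip: ennreal_mult ennreal_plus)
      also have "\<dots> \<le> ennreal \<kappa>"
        using elim by (intro ennreal_leI) (simp add: d_def N_def)
      finally show "nn_avg J (\<lambda>x. \<bar>soft_trunc N (\<phi> x) - avg J (\<lambda>x. soft_trunc N (\<phi> x))\<bar> powr p) \<le> ennreal \<kappa>" .
    qed
  qed
qed

section \<open>Uniform moments and limits of truncations\<close>

text \<open>Chebyshev's inequality supplies the weak bound for \<open>oscillation_decay\<close>;
  summing the geometrically small level sets then bounds the moment of any positive order, uniformly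
  over subcubes.\<close>

lemma moments_bounded:
  fixes Q :: "(real ^ 'n) set" and m :: "(real ^ 'n) set \<Rightarrow> real"
  assumes meas[measurable]: "\<phi> \<in> borel_measurable lebesgue" and p: "0 < p" and q: "0 < q" and \<kappa>: "0 \<le> \<kappa>"
    and osc: "\<And>J. J \<in> subcubes Q \<Longrightarrow> nn_avg J (\<lambda>x. \<bar>\<phi> x - m J\<bar> powr p) \<le> ennreal \<kappa>"
  shows "\<exists>M\<ge>0. \<forall>J\<in>subcubes Q. nn_avg J (\<lambda>x. \<bar>\<phi> x - m J\<bar> powr q) \<le> ennreal M"
proof -
  define N where "N = 4 * (2::real) ^ CARD('n)"
  have N: "N > 0" by (simp add: N_def)
  \<comment> \<open>Chosen so that \<open>r powr p = N * (\<kappa> + 1)\<close>: Chebyshev then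
    gives a share of at most \<open>1 / N\<close>. The added 1 keeps \<open>r\<close> positive when
    \<kappa> is 0.\<close>
  define r where "r = (N * (\<kappa> + 1)) powr (1 / p)"
  have r: "r > 0" using N \<kappa> by (simp add: r_def)
  have rp: "r powr p = N * (\<kappa> + 1)" using p N \<kappa> by (simp add: r_def powr_powr)
  have lvl: "{x. c < \<bar>\<phi> x - d\<bar>} \<in> sets lebesgue" for c d
  proof -
    have "{x \<in> space lebesgue. c < \<bar>\<phi> x - d\<bar>} \<in> sets lebesgue" by measurable
    then show ?thesis by simp
  qed
  have prob_lvl: "emeasure (cube_prob J) {x. c < \<bar>\<phi> x - d\<bar>} =
      ennreal (measure lebesgue {x\<in>J. c < \<bar>\<phi> x - d\<bar>} / measure lebesgue J)" if "J \<in> subcubes Q" for J c d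
  proof -
    have cJ: "is_cube J" using that by (rule subcubes_is_cube)
    interpret prob_space "cube_prob J" by (rule prob_space_cube_prob[OF cJ])
    have "J \<inter> {x. c < \<bar>\<phi> x - d\<bar>} = {x\<in>J. c < \<bar>\<phi> x - d\<bar>}" by blast
    then show ?thesis
      using measure_uniform_measure[OF emeasure_cube(2,3)[OF cJ] lvl[of c d]] by (simp add: emeasure_eq_measure)
  qed
  have weak: "measure lebesgue {x\<in>J. r < \<bar>\<phi> x - m J\<bar>} \<le> measure lebesgue J / N" if J: "J \<in> subcubes Q" for J
  proof -
    have cJ: "is_cube J" using J by (rule subcubes_is_cube)
    let ?A = "{x. r < \<bar>\<phi> x - m J\<bar>}"
    define P where "P = measure lebesgue {x\<in>J. r < \<bar>\<phi> x - m J\<bar>} / measure lebesgue J"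
    have P: "P \<ge> 0" by (simp add: P_def)
    have "ennreal (r powr p) * ennreal P = (\<integral>\<^sup>+x. ennreal (r powr p) * indicator ?A x \<partial>cube_prob J)"
      using lvl[of r "m J"] prob_lvl[OF J, of r "m J"] by (simp add: nn_integral_cmult_indicator P_def)
    also have "\<dots> \<le> (\<integral>\<^sup>+x. ennreal (\<bar>\<phi> x - m J\<bar> powr p) \<partial>cube_prob J)"
      using r p by (intro nn_integral_mono) (auto split: split_indicator intro!: ennreal_leI powr_mono2)
    also have "\<dots> \<le> ennreal \<kappa>" using osc[OF J] cJ by (simp add: nn_avg_cube_prob)
    finally have "r powr p * P \<le> \<kappa>"
      using \<kappa> P by (simp flip: ennreal_mult)
    then have "(\<kappa> + 1) * (N * P) \<le> (\<kappa> + 1) * 1"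
      unfolding rp by (simp add: mult_ac)
    then have "N * P \<le> 1" using \<kappa> mult_le_cancel_left_pos[of "\<kappa> + 1" "N * P" 1] by simp
    then show ?thesis using measure_cube_pos[OF cJ] N unfolding P_def by (simp add: field_simps)
  qed
  have decay: "emeasure (cube_prob J) {x. (2 * real k + 1) * r < \<bar>\<phi> x - m J\<bar>} \<le> ennreal ((1/2) ^ k)"
    if J: "J \<in> subcubes Q" for J k
  proof -
    have "0 < measure lebesgue J" using measure_cube_pos subcubes_is_cube[OF J] by blast
    then show ?thesis
      unfolding prob_lvl[OF J]
      using oscillation_decay[of \<phi> Q r m J k, OF meas weak[unfolded N_def] J]
      by (intro ennreal_leI) (simp add: field_simps)
  qed
  \<comment> \<open>Upper bound for the \<open>q\<close>-th power of the deviation on the shell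
    between \<open>(2 * k + 1) * r\<close> and \<open>(2 * k + 3) * r\<close>.\<close>
  define c where "c k = ((2 * real k + 3) * r) powr q" for k :: nat
  have c: "c k \<ge> 0" for k by (simp add: c_def)
  have summ: "summable (\<lambda>k. c k * (1/2) ^ k)"
  proof (rule summable_comparison_test_bigo)
    show "summable (\<lambda>k. norm ((3/4 :: real) ^ k))" by (simp add: summable_geometric)
    \<comment> \<open>Polynomial growth is absorbed by passing from ratio 1/2 to 3/4.\<close>
    show "(\<lambda>k. c k * (1/2) ^ k) \<in> O(\<lambda>k. (3/4) ^ k)"
      unfolding c_def using r q by real_asymp
  qed
  define M where "M = r powr q + (\<Sum>k. c k * (1/2) ^ k)"
  have sumpos: "(\<Sum>k. c k * (1/2) ^ k) \<ge> 0" using summ c by (intro suminf_nonneg) auto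
  have "nn_avg J (\<lambda>x. \<bar>\<phi> x - m J\<bar> powr q) \<le> ennreal M" if J: "J \<in> subcubes Q" for J
  proof -
    have cJ: "is_cube J" using J by (rule subcubes_is_cube)
    interpret prob_space "cube_prob J" by (rule prob_space_cube_prob[OF cJ])
    define u where "u = (\<lambda>x. \<bar>\<phi> x - m J\<bar>)"
    let ?A = "\<lambda>k. {x. (2 * real k + 1) * r < u x}"
    have A[measurable]: "?A k \<in> sets lebesgue" for k unfolding u_def by (rule lvl)
    have [measurable]: "u \<in> borel_measurable lebesgue" by (simp add: u_def)
    have pw: "ennreal (u x powr q) \<le> ennreal (r powr q) + (\<Sum>k. ennreal (c k) * indicator (?A k) x)" for x
    proof (cases "u x \<le> r")
      case True
      then have "ennreal (u x powr q) \<le> ennreal (r powr q)"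
        using q by (intro ennreal_leI powr_mono2) (auto simp: u_def)
      then show ?thesis by (simp add: add_increasing2)
    next
      case False
      define t where "t = (u x / r - 1) / 2"
      have t: "t > 0" using False r by (simp add: t_def)
      \<comment> \<open>The largest integer strictly below \<open>t\<close>: membership in
        \<open>?A k\<close> is a strict inequality, so the shells are open on the left.\<close>
      define k where "k = nat (\<lceil>t\<rceil> - 1)"
      have k: "real k < t" "t \<le> real k + 1" using t unfolding k_def by linarith+
      have ut: "u x = (2 * t + 1) * r" using r by (simp add: t_def field_simps)
      have "u x \<le> (2 * real k + 3) * r" unfolding ut using k r by (intro mult_right_mono) auto
      then have "ennreal (u x powr q) \<le> ennreal (c k)"
        unfolding c_def using q by (intro ennreal_leI powr_mono2) (auto simp: u_def)
      moreover have "x \<in> ?A k" unfolding mem_Collect_eq ut using k r by (intro mult_strict_right_mono) auto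
      ultimately have "ennreal (u x powr q) \<le> (\<Sum>j\<in>{k}. ennreal (c j) * indicator (?A j) x)" by simp
      also have "\<dots> \<le> (\<Sum>j. ennreal (c j) * indicator (?A j) x)" by (intro sum_le_suminf) auto
      finally show ?thesis by (simp add: add_increasing)
    qed
    have "nn_avg J (\<lambda>x. u x powr q) \<le> (\<integral>\<^sup>+x. ennreal (r powr q) + (\<Sum>k. ennreal (c k) * indicator (?A k) x) \<partial>cube_prob J)"
      using cJ pw by (subst nn_avg_cube_prob) (auto intro!: nn_integral_mono)
    also have "\<dots> = ennreal (r powr q) + (\<Sum>k. ennreal (c k) * emeasure (cube_prob J) (?A k))"
      using emeasure_space_1 by (simp add: nn_integral_add nn_integral_suminf nn_integral_cmult_indicator)
    also have "\<dots> \<le> ennreal (r powr q) + (\<Sum>k. ennreal (c k * (1/2) ^ k))"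
      using decay[OF J] c unfolding u_def
      by (intro add_left_mono suminf_le) (auto simp: ennreal_mult intro!: mult_left_mono)
    also have "\<dots> = ennreal M"
      unfolding M_def using c summ sumpos by (simp add: suminf_ennreal2 ennreal_plus)
    finally show ?thesis by (simp add: u_def)
  qed
  moreover have "M \<ge> 0" using sumpos by (simp add: M_def)
  ultimately show ?thesis by blast
qed

text \<open>The means converge by domination by \<open>|\<phi>|\<close>. For the exponentials, whose
  limit average may be infinite, Fatou's lemma gives the lower bound that is needed.\<close>

lemma soft_trunc_A_infty:
  fixes J :: "(real ^ 'n) set"
  assumes J: "is_cube J" and meas[measurable]: "\<phi> \<in> borel_measurable lebesgue"
    and int: "integrable (cube_prob J) \<phi>"
    and less: "ennreal C * ennreal (exp (avg J \<phi>)) < nn_avg J (\<lambda>x. exp (\<phi> x))" and C: "0 \<le> C"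
  shows "eventually (\<lambda>n. ennreal C < nn_avg J (\<lambda>x. exp (soft_trunc (real (Suc n)) (\<phi> x))) *
      ennreal (exp (- avg J (\<lambda>x. soft_trunc (real (Suc n)) (\<phi> x))))) sequentially"
proof -
  let ?T = "\<lambda>n x. soft_trunc (real (Suc n)) (\<phi> x)"
  have mexp: "(\<lambda>x. exp (\<phi> x)) \<in> borel_measurable lebesgue" by measurable
  have "(\<lambda>n. \<integral>x. ?T n x \<partial>cube_prob J) \<longlonglongrightarrow> (\<integral>x. \<phi> x \<partial>cube_prob J)"
  proof (rule integral_dominated_convergence[where w="\<lambda>x. \<bar>\<phi> x\<bar>"])
    show "AE x in cube_prob J. norm (?T n x) \<le> \<bar>\<phi> x\<bar>" for n
      using soft_trunc_abs_le[of "real (Suc n)"] by simp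
  qed (use int soft_trunc_tendsto in auto)
  then have avg: "(\<lambda>n. avg J (?T n)) \<longlonglongrightarrow> avg J \<phi>" using J by (simp add: avg_cube_prob)
  \<comment> \<open>A finite intermediate value separates the two limits even when the average of
    \<open>exp \<phi>\<close> is infinite.\<close>
  obtain c where c: "ennreal C * ennreal (exp (avg J \<phi>)) < c" "c < nn_avg J (\<lambda>x. exp (\<phi> x))"
    using less dense by blast
  then have "c < top" using top.not_eq_extremum by fastforce
  then obtain c' where c': "c = ennreal c'" "c' \<ge> 0" by (metis less_top_ennreal)
  have "nn_avg J (\<lambda>x. exp (\<phi> x)) = (\<integral>\<^sup>+x. liminf (\<lambda>n. ennreal (exp (?T n x))) \<partial>cube_prob J)"
    unfolding nn_avg_cube_prob[OF J mexp]
  proof (rule nn_integral_cong)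
    fix x
    have "(\<lambda>n. ennreal (exp (?T n x))) \<longlonglongrightarrow> ennreal (exp (\<phi> x))"
      by (intro tendsto_ennrealI tendsto_exp soft_trunc_tendsto)
    then show "ennreal (exp (\<phi> x)) = liminf (\<lambda>n. ennreal (exp (?T n x)))"
      by (rule lim_imp_Liminf[OF trivial_limit_sequentially, symmetric])
  qed
  also have "\<dots> \<le> liminf (\<lambda>n. \<integral>\<^sup>+x. ennreal (exp (?T n x)) \<partial>cube_prob J)"
    by (rule nn_integral_liminf) measurable
  also have "\<dots> = liminf (\<lambda>n. nn_avg J (\<lambda>x. exp (?T n x)))" using J by (simp add: nn_avg_cube_prob)
  finally have "c < liminf (\<lambda>n. nn_avg J (\<lambda>x. exp (?T n x)))" using c(2) by simp
  then have "eventually (\<lambda>n. c < nn_avg J (\<lambda>x. exp (?T n x))) sequentially" by (rule less_LiminfD)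
  moreover have "C * exp (avg J \<phi>) < c'"
    using c(1) C unfolding c'(1) by (simp add: ennreal_less_iff flip: ennreal_mult)
  then have "eventually (\<lambda>n. C * exp (avg J (?T n)) < c') sequentially"
    using avg by (intro order_tendstoD(2)[where y="C * exp (avg J \<phi>)"]) (auto intro!: tendsto_intros)
  ultimately show ?thesis
  proof eventually_elim
    case (elim n)
    have "ennreal C = ennreal (C * exp (avg J (?T n))) * ennreal (exp (- avg J (?T n)))"
      using C by (simp add: exp_minus flip: ennreal_mult)
    also have "\<dots> < ennreal c' * ennreal (exp (- avg J (?T n)))"
    proof -
      have "0 \<le> C * exp (avg J (?T n))" using C by simp
      then have "0 < c'" using elim(2) by linarith
      then have "ennreal (C * exp (avg J (?T n)) * exp (- avg J (?T n))) < ennreal (c' * exp (- avg J (?T n)))"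
        using elim(2) by (intro ennreal_lessI mult_strict_right_mono) auto
      then show ?thesis using C c'(2) by (simp add: ennreal_mult)
    qed
    also have "\<dots> \<le> nn_avg J (\<lambda>x. exp (?T n x)) * ennreal (exp (- avg J (?T n)))"
      using elim(1) unfolding c'(1) by (intro mult_right_mono) auto
    finally show ?case .
  qed
qed

section \<open>The constant as a function of a scaling parameter\<close>

text \<open>The constant of \<open>exp (s * \<psi>)\<close> is 1 at \<open>s = 0\<close> and exceeds
  \<open>C\<close> at \<open>s = 1\<close>. Boundedness of \<psi> makes all the quotients Lipschitz
  in \<open>s\<close> with one common constant, so their supremum is continuous and takes the value
  \<open>C\<close>.\<close>

lemma A_infty_const_intermediate:
  fixes Q :: "(real ^ 'n) set"
  assumes Q: "is_cube Q" and meas[measurable]: "\<psi> \<in> borel_measurable lebesgue"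
    and bdd: "\<And>x. \<bar>\<psi> x\<bar> \<le> B" and C: "1 \<le> C" "ennreal C < A_infty_const Q (\<lambda>x. exp (\<psi> x))"
  obtains s where "0 \<le> s" "s \<le> 1" "A_infty_const Q (\<lambda>x. exp (s * \<psi> x)) = ennreal C"
proof -
  have B: "B \<ge> 0" using bdd[of undefined] by linarith
  \<comment> \<open>The \<open>A_infty\<close> quotient of \<open>exp (s * \<psi>)\<close> on
    \<open>J\<close>, with the mean moved into the exponent.\<close>
  define h where "h J s = avg J (\<lambda>x. exp (s * (\<psi> x - avg J \<psi>)))" for J s
  define F where "F s = (SUP J\<in>subcubes Q. h J s)" for s
  \<comment> \<open>Bounds the derivative \<open>y * exp (s * y)\<close> for
    \<open>|y| \<le> 2 * B\<close> and \<open>s\<close> in the unit interval.\<close>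
  define L where "L = exp (2 * B) * (2 * B)"
  have ne: "subcubes Q \<noteq> {}" using subcubes_self[OF Q] by blast
  have small: "\<bar>\<psi> x - avg J \<psi>\<bar> \<le> 2 * B" if "J \<in> subcubes Q" for J x
  proof -
    have cJ: "is_cube J" using that by (rule subcubes_is_cube)
    interpret prob_space "cube_prob J" by (rule prob_space_cube_prob[OF cJ])
    have i: "integrable (cube_prob J) \<psi>" using bdd by (intro integrable_const_bound[where B=B]) auto
    have "\<bar>\<integral>x. \<psi> x \<partial>cube_prob J\<bar> \<le> (\<integral>x. B \<partial>cube_prob J)"
      using i bdd by (intro order_trans[OF integral_abs_bound] integral_mono) auto
    then have "\<bar>avg J \<psi>\<bar> \<le> B" using cJ by (simp add: avg_cube_prob measure_cube_prob_UNIV)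
    then show ?thesis using bdd[of x] by linarith
  qed
  have ele: "exp (s * (\<psi> x - avg J \<psi>)) \<le> exp (2 * B)" if "J \<in> subcubes Q" "s \<in> {0..1}" for J x s
  proof -
    have "s * (\<psi> x - avg J \<psi>) \<le> \<bar>s\<bar> * \<bar>\<psi> x - avg J \<psi>\<bar>" by (metis abs_ge_self abs_mult)
    also have "\<dots> \<le> 1 * (2 * B)" using small[OF that(1)] that(2) by (intro mult_mono) auto
    finally show ?thesis by simp
  qed
  have ih: "integrable (cube_prob J) (\<lambda>x. exp (s * (\<psi> x - avg J \<psi>)))" if "J \<in> subcubes Q" "s \<in> {0..1}" for J s
  proof -
    interpret prob_space "cube_prob J" by (rule prob_space_cube_prob[OF subcubes_is_cube[OF that(1)]])
    show ?thesis using ele[OF that] by (intro integrable_const_bound[where B="exp (2 * B)"]) auto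
  qed
  have hle: "h J s \<le> exp (2 * B)" if "J \<in> subcubes Q" "s \<in> {0..1}" for J s
  proof -
    have cJ: "is_cube J" using that by (blast intro: subcubes_is_cube)
    interpret prob_space "cube_prob J" by (rule prob_space_cube_prob[OF cJ])
    have "(\<integral>x. exp (s * (\<psi> x - avg J \<psi>)) \<partial>cube_prob J) \<le> (\<integral>x. exp (2 * B) \<partial>cube_prob J)"
      using ih[OF that] ele[OF that] by (intro integral_mono) auto
    then show ?thesis unfolding h_def using cJ by (simp add: avg_cube_prob measure_cube_prob_UNIV)
  qed
  have bddF: "bdd_above ((\<lambda>J. h J s) ` subcubes Q)" if "s \<in> {0..1}" for s
    using hle that by (intro bdd_aboveI2) auto
  have A_F: "A_infty_const Q (\<lambda>x. exp (s * \<psi> x)) = ennreal (F s)" if s: "s \<in> {0..1}" for s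
  proof -
    have "nn_avg J (\<lambda>x. exp (s * \<psi> x)) * ennreal (exp (- avg J (\<lambda>x. ln (exp (s * \<psi> x))))) = ennreal (h J s)"
      if J: "J \<in> subcubes Q" for J
    proof -
      have cJ: "is_cube J" using J by (rule subcubes_is_cube)
      have "nn_avg J (\<lambda>x. exp (s * \<psi> x)) * ennreal (exp (- avg J (\<lambda>x. ln (exp (s * \<psi> x))))) =
          (\<integral>\<^sup>+x. ennreal (exp (s * \<psi> x)) * ennreal (exp (- (s * avg J \<psi>))) \<partial>cube_prob J)"
        using cJ by (simp add: nn_avg_cube_prob avg_cube_prob nn_integral_multc)
      also have "\<dots> = (\<integral>\<^sup>+x. ennreal (exp (s * (\<psi> x - avg J \<psi>))) \<partial>cube_prob J)"
        by (intro nn_integral_cong) (simp add: algebra_simps flip: ennreal_mult exp_add)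
      also have "\<dots> = ennreal (h J s)"
        unfolding h_def using nn_avg_eq_avg[OF cJ _ ih[OF J s]] cJ by (simp add: nn_avg_cube_prob)
      finally show ?thesis .
    qed
    then have "A_infty_const Q (\<lambda>x. exp (s * \<psi> x)) = (SUP J\<in>subcubes Q. ennreal (h J s))"
      unfolding A_infty_const_def by (intro SUP_cong) auto
    \<comment> \<open>Boundedness and nonemptiness of the family let the extended supremum be read
      as a real one.\<close>
    also have "\<dots> = ennreal (F s)"
    proof (rule antisym)
      show "(SUP J\<in>subcubes Q. ennreal (h J s)) \<le> ennreal (F s)"
        unfolding F_def using bddF[OF s] by (intro SUP_least ennreal_leI cSUP_upper)
      then have "(SUP J\<in>subcubes Q. ennreal (h J s)) < top" using ennreal_less_top le_less_trans by blast
      then obtain S where S: "(SUP J\<in>subcubes Q. ennreal (h J s)) = ennreal S" "0 \<le> S"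
        by (metis less_top_ennreal)
      have "h J s \<le> S" if "J \<in> subcubes Q" for J
        using SUP_upper[OF that, of "\<lambda>J. ennreal (h J s)"] S by simp
      then show "ennreal (F s) \<le> (SUP J\<in>subcubes Q. ennreal (h J s))"
        unfolding S(1) F_def by (intro ennreal_leI cSUP_least ne)
    qed
    finally show ?thesis .
  qed
  have h_lip: "h J s \<le> h J t + L * \<bar>s - t\<bar>" if J: "J \<in> subcubes Q" and st: "s \<in> {0..1}" "t \<in> {0..1}" for J s t
  proof -
    have cJ: "is_cube J" using J by (rule subcubes_is_cube)
    interpret prob_space "cube_prob J" by (rule prob_space_cube_prob[OF cJ])
    have "exp (s * y) \<le> exp (t * y) + L * \<bar>s - t\<bar>" if y: "exp (s * y) \<le> exp (2 * B)" "\<bar>y\<bar> \<le> 2 * B" for y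
    proof -
      \<comment> \<open>Convexity: the exponential lies above its tangent at
        \<open>s * y\<close>.\<close>
      have "exp (s * y) * (1 + (t - s) * y) \<le> exp (s * y) * exp ((t - s) * y)"
        by (intro mult_left_mono exp_ge_add_one_self) auto
      also have "\<dots> = exp (t * y)" by (simp add: algebra_simps flip: exp_add)
      finally have "exp (s * y) \<le> exp (t * y) + exp (s * y) * ((s - t) * y)" by (simp add: algebra_simps)
      also have "exp (s * y) * ((s - t) * y) \<le> exp (s * y) * (\<bar>s - t\<bar> * \<bar>y\<bar>)"
        by (intro mult_left_mono) (metis abs_ge_self abs_mult, simp)
      also have "\<dots> \<le> exp (2 * B) * (\<bar>s - t\<bar> * (2 * B))"
        using y by (intro mult_mono) auto
      finally show ?thesis by (simp add: L_def mult_ac)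
    qed
    then have "(\<integral>x. exp (s * (\<psi> x - avg J \<psi>)) \<partial>cube_prob J) \<le>
        (\<integral>x. exp (t * (\<psi> x - avg J \<psi>)) + L * \<bar>s - t\<bar> \<partial>cube_prob J)"
      using ih[OF J st(1)] ih[OF J st(2)] ele[OF J st(1)] small[OF J] by (intro integral_mono) auto
    then show ?thesis
      using ih[OF J st(2)] cJ unfolding h_def by (simp add: avg_cube_prob measure_cube_prob_UNIV)
  qed
  have F_lip: "F s \<le> F t + L * \<bar>s - t\<bar>" if st: "s \<in> {0..1}" "t \<in> {0..1}" for s t
    unfolding F_def[of s]
  proof (rule cSUP_least[OF ne])
    fix J assume J: "J \<in> subcubes Q"
    have "h J t \<le> F t" unfolding F_def by (rule cSUP_upper[OF J bddF[OF st(2)]])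
    with h_lip[OF J st] show "h J s \<le> F t + L * \<bar>s - t\<bar>" by simp
  qed
  have "L-lipschitz_on {0..1} F"
  proof (rule lipschitz_onI)
    show "dist (F s) (F t) \<le> L * dist s t" if "s \<in> {0..1}" "t \<in> {0..1}" for s t
      using F_lip[OF that] F_lip[OF that(2,1)] by (simp add: dist_real_def abs_minus_commute abs_le_iff)
  qed (use B in \<open>simp add: L_def\<close>)
  then have cont: "continuous_on {0..1} F" by (rule lipschitz_on_continuous_on)
  have "h J 0 = 1" if "J \<in> subcubes Q" for J
    using subcubes_is_cube[OF that] by (simp add: h_def avg_cube_prob measure_cube_prob_UNIV)
  then have "F 0 = 1" unfolding F_def using ne by (simp cong: SUP_cong)
  moreover have "C \<le> F 1"
  proof -
    have "ennreal C < ennreal (F 1)" using C(2) A_F[of 1] by simp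
    then show ?thesis by (metis ennreal_leI linorder_not_le less_imp_le)
  qed
  ultimately obtain s where "0 \<le> s" "s \<le> 1" "F s = C"
    using IVT'[of F 0 C 1] C(1) cont by auto
  with A_F[of s] show ?thesis by (intro that[of s]) auto
qed

section \<open>The John--Nirenberg constants\<close>

lemma avg_cong: "(\<And>x. x \<in> J \<Longrightarrow> f x = g x) \<Longrightarrow> avg J f = avg J g"
  unfolding avg_def set_lebesgue_integral_def
  by (intro arg_cong2[where f="(/)"] Bochner_Integration.integral_cong) (auto split: split_indicator)

lemma nn_avg_cong: "(\<And>x. x \<in> J \<Longrightarrow> f x = g x) \<Longrightarrow> nn_avg J f = nn_avg J g"
  unfolding nn_avg_def
  by (intro arg_cong2[where f="(/)"] nn_integral_cong) (auto split: split_indicator)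

lemma enn_powr_inverse_le:
  assumes "0 < p" "0 \<le> \<epsilon>" "enn_powr x (1 / p) \<le> ennreal \<epsilon>"
  shows "x \<le> ennreal (\<epsilon> powr p)"
proof (cases x rule: ennreal_cases)
  case (real y)
  then have "y powr (1 / p) \<le> \<epsilon>" using assms by (simp add: enn_powr_def)
  then have "(y powr (1 / p)) powr p \<le> \<epsilon> powr p" using assms by (intro powr_mono2) auto
  then show ?thesis using real assms by (simp add: powr_powr ennreal_leI)
next
  case top
  then show ?thesis using assms by (simp add: enn_powr_def top_unique)
qed

text \<open>Membership in \<open>BMO\<close> constrains \<phi> on \<open>Q\<close> only. Setting it
  to 0 outside makes it measurable on the whole space and changes no average over a subcube.\<close>

lemma BMO_measurable_representative:
  fixes Q :: "(real ^ 'n) set"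
  assumes Q: "is_cube Q" and p: "0 < p" and \<phi>: "\<phi> \<in> BMO Q p" and \<epsilon>: "0 \<le> \<epsilon>" "BMO_norm Q p \<phi> \<le> ennreal \<epsilon>"
  obtains \<phi>' where "\<phi>' \<in> borel_measurable lebesgue" "integrable (cube_prob Q) \<phi>'" "\<And>x. x \<in> Q \<Longrightarrow> \<phi>' x = \<phi> x"
    "\<And>J. J \<in> subcubes Q \<Longrightarrow> nn_avg J (\<lambda>x. \<bar>\<phi>' x - avg J \<phi>'\<bar> powr p) \<le> ennreal (\<epsilon> powr p)"
proof -
  define \<phi>' where "\<phi>' = (\<lambda>x. indicator Q x *\<^sub>R \<phi> x)"
  have "integrable lebesgue \<phi>'" using \<phi> by (simp add: BMO_def set_integrable_def \<phi>'_def)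
  then have m: "\<phi>' \<in> borel_measurable lebesgue" by simp
  have eq: "\<phi>' x = \<phi> x" if "x \<in> Q" for x using that by (simp add: \<phi>'_def)
  have "\<phi>' absolutely_integrable_on Q"
    using \<phi> unfolding BMO_def set_integrable_def \<phi>'_def
    by (simp add: indicator_inter_arith[symmetric] mult.assoc[symmetric] del: scaleR_scaleR)
  then have i: "integrable (cube_prob Q) \<phi>'" using absolutely_integrable_on_cube_iff[OF Q m] by simp
  have "nn_avg J (\<lambda>x. \<bar>\<phi>' x - avg J \<phi>'\<bar> powr p) \<le> ennreal (\<epsilon> powr p)" if J: "J \<in> subcubes Q" for J
  proof -
    have JQ: "J \<subseteq> Q" using J by (simp add: subcubes_def)
    have "enn_powr (nn_avg J (\<lambda>x. \<bar>\<phi> x - avg J \<phi>\<bar> powr p)) (1 / p) \<le> ennreal \<epsilon>"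
      using \<epsilon>(2) unfolding BMO_norm_def SUP_le_iff using J by blast
    from enn_powr_inverse_le[OF p \<epsilon>(1) this]
    have "nn_avg J (\<lambda>x. \<bar>\<phi> x - avg J \<phi>\<bar> powr p) \<le> ennreal (\<epsilon> powr p)" .
    moreover have "avg J \<phi>' = avg J \<phi>" using JQ eq by (intro avg_cong) auto
    then have "nn_avg J (\<lambda>x. \<bar>\<phi>' x - avg J \<phi>'\<bar> powr p) = nn_avg J (\<lambda>x. \<bar>\<phi> x - avg J \<phi>\<bar> powr p)"
      using JQ eq by (intro nn_avg_cong) auto
    ultimately show ?thesis by simp
  qed
  with m i eq show ?thesis by (rule that)
qed

section \<open>From Bellman minorants to exponential bounds\<close>

text \<open>No finiteness of the constant of \<open>exp \<phi>\<close> is assumed. A violation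
  survives a soft truncation whose oscillation is at most \<kappa>; scaling by some \<open>s\<close>
  in the unit interval brings the constant to exactly \<open>C\<close>, and
  \<open>bellman_minorant_le_oscillation\<close> contradicts \<open>large\<close>.\<close>

lemma large_A_infty_const_excluded:
  fixes Q :: "(real ^ 'n) set"
  assumes Q: "is_cube Q" and p: "0 < p" and meas: "\<phi> \<in> borel_measurable lebesgue"
    and int: "integrable (cube_prob Q) \<phi>"
    and osc: "\<And>J. J \<in> subcubes Q \<Longrightarrow> nn_avg J (\<lambda>x. \<bar>\<phi> x - avg J \<phi>\<bar> powr p) \<le> ennreal \<kappa>'"
    and \<kappa>: "0 \<le> \<kappa>'" "\<kappa>' < \<kappa>" and C: "1 \<le> C"
    and bell: "\<And>t. 1 \<le> t \<Longrightarrow> t \<le> C \<Longrightarrow> ereal (\<beta> t) \<le> enn2ereal (lower_bellman Q p C (0, t))"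
    and cont: "continuous_on {1..C} \<beta>" and large: "\<kappa> < \<beta> C"
    and J: "J \<in> subcubes Q"
  shows "nn_avg J (\<lambda>x. exp (\<phi> x)) \<le> ennreal C * ennreal (exp (avg J \<phi>))"
proof (rule ccontr)
  assume "\<not> ?thesis"
  then have less: "ennreal C * ennreal (exp (avg J \<phi>)) < nn_avg J (\<lambda>x. exp (\<phi> x))" by simp
  have moments: "\<exists>M\<ge>0. \<forall>J\<in>subcubes Q. nn_avg J (\<lambda>x. \<bar>\<phi> x - avg J \<phi>\<bar> powr q) \<le> ennreal M" if "0 < q" for q
    using moments_bounded[OF meas p that \<kappa>(1), of Q "\<lambda>J. avg J \<phi>"] osc by blast
  from moments[of 2] obtain M2 where M2: "M2 \<ge> 0"
      "\<And>J. J \<in> subcubes Q \<Longrightarrow> nn_avg J (\<lambda>x. \<bar>\<phi> x - avg J \<phi>\<bar> powr 2) \<le> ennreal M2"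
    by (metis zero_less_numeral)
  from moments[of "2 * p"] obtain M3 where M3: "M3 \<ge> 0"
      "\<And>J. J \<in> subcubes Q \<Longrightarrow> nn_avg J (\<lambda>x. \<bar>\<phi> x - avg J \<phi>\<bar> powr (2 * p)) \<le> ennreal M3"
    using p by (metis mult_pos_pos zero_less_numeral)
  let ?T = "\<lambda>n x. soft_trunc (real (Suc n)) (\<phi> x)"
  have "eventually (\<lambda>n. (\<forall>J\<in>subcubes Q. nn_avg J (\<lambda>x. \<bar>?T n x - avg J (?T n)\<bar> powr p) \<le> ennreal \<kappa>) \<and>
     ennreal C < nn_avg J (\<lambda>x. exp (?T n x)) * ennreal (exp (- avg J (?T n)))) sequentially"
    using soft_trunc_oscillation[OF Q p meas int osc \<kappa> M2(2,1) M3(2,1)]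
      soft_trunc_A_infty[OF subcubes_is_cube[OF J] meas integrable_subcube[OF Q J meas int] less] C
    by (intro eventually_conj) auto
  then obtain n where n: "\<And>J. J \<in> subcubes Q \<Longrightarrow> nn_avg J (\<lambda>x. \<bar>?T n x - avg J (?T n)\<bar> powr p) \<le> ennreal \<kappa>"
    "ennreal C < nn_avg J (\<lambda>x. exp (?T n x)) * ennreal (exp (- avg J (?T n)))"
    using eventually_happens'[OF trivial_limit_sequentially] by blast
  define \<psi> where "\<psi> = ?T n"
  have \<psi>[measurable]: "\<psi> \<in> borel_measurable lebesgue"
    using measurable_compose[OF meas soft_trunc_measurable] by (simp add: \<psi>_def)
  have bdd: "\<bar>\<psi> x\<bar> \<le> 2 * real (Suc n)" for x
    unfolding \<psi>_def by (rule soft_trunc_bounded) simp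
  have "ennreal C < A_infty_const Q (\<lambda>x. exp (\<psi> x))"
    using n(2) unfolding A_infty_const_def less_SUP_iff \<psi>_def by (intro bexI[OF _ J]) simp
  then obtain s where s: "0 \<le> s" "s \<le> 1" "A_infty_const Q (\<lambda>x. exp (s * \<psi> x)) = ennreal C"
    using A_infty_const_intermediate[OF Q \<psi> bdd C] by blast
  interpret prob_space "cube_prob Q" by (rule prob_space_cube_prob[OF Q])
  have bdds: "\<bar>s * \<psi> x\<bar> \<le> 2 * real (Suc n)" for x
    using mult_mono[of "\<bar>s\<bar>" 1 "\<bar>\<psi> x\<bar>" "2 * real (Suc n)"] s bdd[of x] by (simp add: abs_mult)
  have "\<beta> C \<le> \<kappa>"
  proof (rule bellman_minorant_le_oscillation[OF Q _ _ _ s(3) C _ _ bell cont])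
    show "(\<lambda>x. s * \<psi> x) \<in> borel_measurable lebesgue" by measurable
    show "integrable (cube_prob Q) (\<lambda>x. s * \<psi> x)"
      using bdds by (intro integrable_const_bound[where B="2 * real (Suc n)"]) auto
    have "exp (s * \<psi> x) \<le> exp (2 * real (Suc n))" for x
      using bdds[of x] by (simp only: exp_le_cancel_iff abs_le_iff)
    then show "integrable (cube_prob Q) (\<lambda>x. exp (s * \<psi> x))"
      by (intro integrable_const_bound[where B="exp (2 * real (Suc n))"]) auto
    show "nn_avg K (\<lambda>x. \<bar>s * \<psi> x - avg K (\<lambda>x. s * \<psi> x)\<bar> powr p) \<le> ennreal \<kappa>" if K: "K \<in> subcubes Q" for K
    proof -
      have cK: "is_cube K" using K by (rule subcubes_is_cube)
      have "avg K (\<lambda>x. s * \<psi> x) = s * avg K \<psi>" using cK by (simp add: avg_cube_prob)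
      \<comment> \<open>Scaling by \<open>s\<close> with \<open>0 \<le> s \<le> 1\<close> only
        shrinks the deviation from the mean.\<close>
      then have "nn_avg K (\<lambda>x. \<bar>s * \<psi> x - avg K (\<lambda>x. s * \<psi> x)\<bar> powr p) \<le> nn_avg K (\<lambda>x. \<bar>\<psi> x - avg K \<psi>\<bar> powr p)"
        using cK s p
        by (auto simp: nn_avg_cube_prob abs_mult mult_left_le_one_le simp flip: right_diff_distrib
            intro!: nn_integral_mono ennreal_leI powr_mono2)
      also have "\<dots> \<le> ennreal \<kappa>" using n(1)[OF K] by (simp only: \<psi>_def)
      finally show ?thesis .
    qed
  qed (use \<kappa> in auto)
  with large show False by simp
qed

text \<open>Reduces a bound on the best constant to measurable representatives. The infimum of the
  admissible constants is itself admissible, so the inequality with \<open>JN_const\<close> may be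
  assumed; this is informative when that constant is finite.\<close>

lemma JN_const_leI:
  fixes Q :: "(real ^ 'n) set"
  assumes Q: "is_cube Q" and p: "0 < p" and \<epsilon>: "0 \<le> \<epsilon>"
    and bound: "\<And>\<phi> J. \<phi> \<in> borel_measurable lebesgue \<Longrightarrow> integrable (cube_prob Q) \<phi> \<Longrightarrow>
      (\<And>J. J \<in> subcubes Q \<Longrightarrow> nn_avg J (\<lambda>x. \<bar>\<phi> x - avg J \<phi>\<bar> powr p) \<le> ennreal (\<epsilon> powr p)) \<Longrightarrow>
      (\<And>J. J \<in> subcubes Q \<Longrightarrow> nn_avg J (\<lambda>x. exp (\<phi> x)) \<le> JN_const Q \<epsilon> p * ennreal (exp (avg J \<phi>))) \<Longrightarrow>
      J \<in> subcubes Q \<Longrightarrow> nn_avg J (\<lambda>x. exp (\<phi> x)) \<le> c * ennreal (exp (avg J \<phi>))"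
  shows "JN_const Q \<epsilon> p \<le> c"
  unfolding JN_const_def
proof (rule Inf_lower, intro CollectI ballI impI)
  fix \<phi> J assume \<phi>: "\<phi> \<in> BMO Q p" "BMO_norm Q p \<phi> \<le> ennreal \<epsilon>" and J: "J \<in> subcubes Q"
  obtain \<phi>' where \<phi>': "\<phi>' \<in> borel_measurable lebesgue" "integrable (cube_prob Q) \<phi>'" "\<And>x. x \<in> Q \<Longrightarrow> \<phi>' x = \<phi> x"
    "\<And>J. J \<in> subcubes Q \<Longrightarrow> nn_avg J (\<lambda>x. \<bar>\<phi>' x - avg J \<phi>'\<bar> powr p) \<le> ennreal (\<epsilon> powr p)"
    using BMO_measurable_representative[OF Q p \<phi>(1) \<epsilon> \<phi>(2)] by blast
  have eq: "avg K \<phi>' = avg K \<phi>" "nn_avg K (\<lambda>x. exp (\<phi>' x)) = nn_avg K (\<lambda>x. exp (\<phi> x))"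
    if "K \<in> subcubes Q" for K
    using that \<phi>'(3) by (auto simp: subcubes_def intro!: avg_cong nn_avg_cong)
  have "nn_avg K (\<lambda>x. exp (\<phi>' x)) \<le> JN_const Q \<epsilon> p * ennreal (exp (avg K \<phi>'))" if K: "K \<in> subcubes Q" for K
  proof -
    \<comment> \<open>Moving the positive finite factor \<open>exp (avg K \<phi>)\<close> to the
      left isolates \<open>c\<close>, so that the infimum over all admissible \<open>c\<close> can
      be taken.\<close>
    have ge: "nn_avg K (\<lambda>x. exp (\<phi> x)) * ennreal (exp (- avg K \<phi>)) \<le> JN_const Q \<epsilon> p"
      unfolding JN_const_def
    proof (rule Inf_greatest, clarify)
      fix c assume "\<forall>\<phi>\<in>BMO Q p. BMO_norm Q p \<phi> \<le> ennreal \<epsilon> \<longrightarrow>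
         (\<forall>J\<in>subcubes Q. nn_avg J (\<lambda>x. exp (\<phi> x)) \<le> c * ennreal (exp (avg J \<phi>)))"
      then have "nn_avg K (\<lambda>x. exp (\<phi> x)) \<le> c * ennreal (exp (avg K \<phi>))" using \<phi> K by blast
      from mult_right_mono[OF this, of "ennreal (exp (- avg K \<phi>))"]
      show "nn_avg K (\<lambda>x. exp (\<phi> x)) * ennreal (exp (- avg K \<phi>)) \<le> c"
        by (simp add: mult.assoc flip: ennreal_mult exp_add)
    qed
    from mult_right_mono[OF this, of "ennreal (exp (avg K \<phi>))"]
    show ?thesis using eq[OF K] by (simp add: mult.assoc flip: ennreal_mult exp_add)
  qed
  from bound[OF \<phi>'(1,2,4) this J] show "nn_avg J (\<lambda>x. exp (\<phi> x)) \<le> c * ennreal (exp (avg J \<phi>))"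
    using eq[OF J] by simp
qed

text \<open>Finiteness of the best constant makes the constant \<open>C\<close> of
  \<open>exp \<phi>\<close> finite, so the near-extremal argument applies to \<phi> itself, without
  truncation. It excludes every \<open>C > C'\<close>, also at the exact level
  \<open>\<epsilon> powr p\<close>.\<close>

lemma JN_const_le_inverse:
  fixes Q :: "(real ^ 'n) set" and \<beta> :: "real \<Rightarrow> real \<Rightarrow> real"
  assumes Q: "is_cube Q" and p: "0 < p" and \<epsilon>: "0 \<le> \<epsilon>" and fin: "JN_const Q \<epsilon> p < \<infinity>"
    and bell: "\<And>C t. 1 \<le> C \<Longrightarrow> 1 \<le> t \<Longrightarrow> t \<le> C \<Longrightarrow> ereal (\<beta> C t) \<le> enn2ereal (lower_bellman Q p C (0, t))"
    and cont: "\<And>C. 1 \<le> C \<Longrightarrow> continuous_on {1..C} (\<beta> C)"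
    and C': "1 \<le> C'" and large: "\<And>C. C' < C \<Longrightarrow> \<epsilon> powr p < \<beta> C C"
  shows "JN_const Q \<epsilon> p \<le> ennreal C'"
proof (rule JN_const_leI[OF Q p \<epsilon>])
  fix \<phi> J
  assume \<phi>[measurable]: "\<phi> \<in> borel_measurable lebesgue" and int: "integrable (cube_prob Q) \<phi>"
    and osc: "\<And>J. J \<in> subcubes Q \<Longrightarrow> nn_avg J (\<lambda>x. \<bar>\<phi> x - avg J \<phi>\<bar> powr p) \<le> ennreal (\<epsilon> powr p)"
    and JN: "\<And>J. J \<in> subcubes Q \<Longrightarrow> nn_avg J (\<lambda>x. exp (\<phi> x)) \<le> JN_const Q \<epsilon> p * ennreal (exp (avg J \<phi>))"
    and J: "J \<in> subcubes Q"
  have up: "nn_avg K (\<lambda>x. exp (\<phi> x)) * ennreal (exp (- avg K \<phi>)) \<le> A_infty_const Q (\<lambda>x. exp (\<phi> x))"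
    if "K \<in> subcubes Q" for K
    unfolding A_infty_const_def using that by (intro SUP_upper2[OF that]) simp
  have "A_infty_const Q (\<lambda>x. exp (\<phi> x)) \<le> JN_const Q \<epsilon> p"
    unfolding A_infty_const_def
  proof (rule SUP_least)
    fix K assume "K \<in> subcubes Q"
    from mult_right_mono[OF JN[OF this], of "ennreal (exp (- avg K \<phi>))"]
    show "nn_avg K (\<lambda>x. exp (\<phi> x)) * ennreal (exp (- avg K (\<lambda>x. ln (exp (\<phi> x))))) \<le> JN_const Q \<epsilon> p"
      by (simp add: mult.assoc flip: ennreal_mult exp_add)
  qed
  then have "A_infty_const Q (\<lambda>x. exp (\<phi> x)) < top" using fin by (simp add: le_less_trans)
  then obtain C where C: "A_infty_const Q (\<lambda>x. exp (\<phi> x)) = ennreal C" "0 \<le> C"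
    by (metis less_top_ennreal)
  \<comment> \<open>The John--Nirenberg inequality on \<open>Q\<close> itself makes
    \<open>exp \<phi>\<close> integrable there.\<close>
  have "nn_avg Q (\<lambda>x. exp (\<phi> x)) < \<infinity>"
    using JN[OF subcubes_self[OF Q]] fin
    by (metis ennreal_less_top ennreal_mult_less_top infinity_ennreal_def le_less_trans)
  then have inte: "integrable (cube_prob Q) (\<lambda>x. exp (\<phi> x))"
    using Q by (intro integrableI_bounded) (auto simp: nn_avg_cube_prob)
  have "C \<le> C'"
  proof (rule ccontr)
    assume "\<not> C \<le> C'"
    then have "1 \<le> C" "\<epsilon> powr p < \<beta> C C" using C' large by auto
    moreover have "\<beta> C C \<le> \<epsilon> powr p"
      using bellman_minorant_le_oscillation[OF Q \<phi> int inte C(1) \<open>1 \<le> C\<close> osc _ bell cont] \<open>1 \<le> C\<close> by simp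
    ultimately show False by simp
  qed
  then have "nn_avg J (\<lambda>x. exp (\<phi> x)) * ennreal (exp (- avg J \<phi>)) \<le> ennreal C'"
    using up[OF J] unfolding C(1) using ennreal_leI order_trans by blast
  from mult_right_mono[OF this, of "ennreal (exp (avg J \<phi>))"]
  show "nn_avg J (\<lambda>x. exp (\<phi> x)) \<le> ennreal C' * ennreal (exp (avg J \<phi>))"
    by (simp add: mult.assoc flip: ennreal_mult exp_add)
qed

text \<open>The first claim is stated in the extended reals, since the definitions allow infinite
  values. In the second, \<epsilon> lies in the range of \<open>G\<close>, where the inverse is
  defined, and \<open>b C (0, C)\<close> is nonnegative from \<open>C0\<close> on, so that
  \<open>powr\<close> by \<open>1 / p\<close> is a genuine root.\<close>

theorem theorem1p12:
  fixes Q :: "(real ^ 'n) set" and p :: real and b :: "real \<Rightarrow> real \<times> real \<Rightarrow> real"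
  assumes "is_cube Q" and "0 < p"
    and "\<And>C x. 1 \<le> C \<Longrightarrow> x \<in> Omega C \<Longrightarrow> ereal (b C x) \<le> enn2ereal (lower_bellman Q p C x)"
    and "\<And>C. 1 \<le> C \<Longrightarrow> continuous_on {1..C} (\<lambda>t. b C (0, t))"
  shows "Limsup at_top (\<lambda>C. ereal (b C (0, C))) \<le> enn2ereal (enn_powr (JN_eps0 Q p) p) \<and>
    (let G = (\<lambda>C. b C (0, C) powr (1 / p)) in
      \<forall>C0\<ge>1. (\<forall>C\<ge>C0. 0 \<le> b C (0, C)) \<longrightarrow> strict_mono_on {C0..} G \<longrightarrow>
        (\<forall>\<epsilon>\<in>G ` {C0..}. G C0 \<le> \<epsilon> \<and> ennreal \<epsilon> < JN_eps0 Q p \<longrightarrow>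
           JN_const Q \<epsilon> p \<le> ennreal (the_inv_into {C0..} G \<epsilon>)))"
proof -
  note Q = assms(1) and p = assms(2)
  have bell: "ereal (b C (0, t)) \<le> enn2ereal (lower_bellman Q p C (0, t))" if "1 \<le> C" "1 \<le> t" "t \<le> C" for C t
    using that by (intro assms(3)) (auto simp: Omega_def)
  have fin: "JN_const Q \<epsilon> p < \<infinity>" if "0 \<le> \<epsilon>" "ennreal \<epsilon> < JN_eps0 Q p" for \<epsilon>
    using that unfolding JN_eps0_def less_Sup_iff by blast
  have "Limsup at_top (\<lambda>C. ereal (b C (0, C))) \<le> enn2ereal (enn_powr (JN_eps0 Q p) p)"
  proof (rule ccontr)
    assume "\<not> ?thesis"
    then have gt: "enn2ereal (enn_powr (JN_eps0 Q p) p) < Limsup at_top (\<lambda>C. ereal (b C (0, C)))" by simp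
    \<comment> \<open>An infinite threshold has an infinite power, which no limit superior can
      exceed.\<close>
    then have "JN_eps0 Q p \<noteq> \<infinity>" by (auto simp: enn_powr_def)
    then obtain e where e: "JN_eps0 Q p = ennreal e" "0 \<le> e" by (cases "JN_eps0 Q p" rule: ennreal_cases) auto
    then have "ereal (e powr p) < Limsup at_top (\<lambda>C. ereal (b C (0, C)))"
      using gt by (simp add: enn_powr_def)
    then obtain \<kappa> where \<kappa>: "e powr p < \<kappa>" "ereal \<kappa> < Limsup at_top (\<lambda>C. ereal (b C (0, C)))"
      using ereal_dense2 by (metis ereal_less_eq(3) less_ereal.simps(1))
    have \<kappa>0: "\<kappa> > 0" using \<kappa>(1) powr_ge_zero[of e p] by linarith
    \<comment> \<open>The root of a level strictly between the two sides. It exceeds the threshold,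
      so some smaller \<epsilon>' has an infinite constant.\<close>
    define \<epsilon> where "\<epsilon> = \<kappa> powr (1 / p)"
    have \<epsilon>p: "\<epsilon> powr p = \<kappa>" using p \<kappa>0 by (simp add: \<epsilon>_def powr_powr)
    have \<epsilon>0: "\<epsilon> > 0" using \<kappa>0 by (simp add: \<epsilon>_def)
    have "e < \<epsilon>"
    proof (rule ccontr)
      assume "\<not> e < \<epsilon>"
      then have "\<epsilon> powr p \<le> e powr p" using \<epsilon>0 p by (intro powr_mono2) auto
      then show False using \<kappa>(1) \<epsilon>p by simp
    qed
    then have "JN_eps0 Q p < ennreal \<epsilon>" using e \<epsilon>0 by (simp add: ennreal_lessI)
    then have "\<not> (\<forall>\<epsilon>'\<ge>0. ennreal \<epsilon>' < ennreal \<epsilon> \<longrightarrow> JN_const Q \<epsilon>' p < \<infinity>)"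
      using Sup_upper[of "ennreal \<epsilon>" "{r. \<forall>\<epsilon>\<ge>0. ennreal \<epsilon> < r \<longrightarrow> JN_const Q \<epsilon> p < \<infinity>}"]
      unfolding JN_eps0_def by (auto simp: not_le[symmetric])
    then obtain \<epsilon>' where \<epsilon>': "0 \<le> \<epsilon>'" "ennreal \<epsilon>' < ennreal \<epsilon>" "\<not> JN_const Q \<epsilon>' p < \<infinity>" by blast
    then have "\<epsilon>' < \<epsilon>" by (simp add: ennreal_less_iff)
    then have less: "\<epsilon>' powr p < \<kappa>" unfolding \<epsilon>p[symmetric] using \<epsilon>'(1) p by (intro powr_less_mono2) auto
    \<comment> \<open>Since \<kappa> is below the limit superior, some \<open>C \<ge> 1\<close> has
      \<open>b C (0, C)\<close> above \<kappa>. This single \<open>C\<close> bounds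
      \<open>JN_const Q \<epsilon>' p\<close>, contrary to the choice of \<epsilon>'.\<close>
    have "\<not> eventually (\<lambda>C. ereal (b C (0, C)) \<le> ereal \<kappa>) at_top"
      using \<kappa>(2) Limsup_bounded[of "\<lambda>C. ereal (b C (0, C))" "ereal \<kappa>" at_top] by auto
    then have "frequently (\<lambda>C. \<kappa> < b C (0, C)) at_top"
      by (simp add: frequently_def not_less)
    from frequently_eventually_frequently[OF this eventually_ge_at_top[of 1]]
    obtain C where C: "\<kappa> < b C (0, C)" "1 \<le> C" using frequently_ex by blast
    have "JN_const Q \<epsilon>' p \<le> ennreal C"
      using large_A_infty_const_excluded[OF Q p _ _ _ _ less C(2) bell[OF C(2)] assms(4)[OF C(2)] C(1)]
      by (intro JN_const_leI[OF Q p \<epsilon>'(1)]) auto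
    then show False using \<epsilon>'(3) by (simp add: le_less_trans)
  qed
  moreover have "JN_const Q \<epsilon> p \<le> ennreal (the_inv_into {C0..} G \<epsilon>)"
    if G: "G = (\<lambda>C. b C (0, C) powr (1 / p))" and C0: "1 \<le> C0" and nonneg: "\<forall>C\<ge>C0. 0 \<le> b C (0, C)"
      and mono: "strict_mono_on {C0..} G" and \<epsilon>: "\<epsilon> \<in> G ` {C0..}" "ennreal \<epsilon> < JN_eps0 Q p" for G C0 \<epsilon>
  proof -
    obtain C' where C': "C' \<ge> C0" "\<epsilon> = G C'" using \<epsilon>(1) by auto
    have "the_inv_into {C0..} G \<epsilon> = C'"
      unfolding C'(2) using C'(1) strict_mono_on_imp_inj_on[OF mono] by (intro the_inv_into_f_f) auto
    moreover have \<epsilon>0: "0 \<le> \<epsilon>" by (simp add: C'(2) G)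
    have "JN_const Q \<epsilon> p \<le> ennreal C'"
    proof (rule JN_const_le_inverse[OF Q p \<epsilon>0 fin[OF \<epsilon>0 \<epsilon>(2)], where \<beta>="\<lambda>C t. b C (0, t)"])
      \<comment> \<open>Every \<open>C\<close> beyond \<open>C'\<close>, the preimage of \<epsilon>,
        has \<open>G C\<close> strictly above \<epsilon>; taking \<open>p\<close>-th powers recovers
        \<open>b C (0, C)\<close> because it is nonnegative.\<close>
      show "\<epsilon> powr p < b C (0, C)" if "C' < C" for C
      proof -
        have "\<epsilon> < G C" unfolding C'(2) using mono that C'(1) by (auto simp: strict_mono_on_def)
        then have "\<epsilon> powr p < G C powr p" using \<epsilon>0 p by (intro powr_less_mono2) auto
        also have "\<dots> = b C (0, C)" using nonneg that C'(1) p by (simp add: G powr_powr)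
        finally show ?thesis .
      qed
    qed (use bell assms(4) C0 C'(1) in auto)
    ultimately show ?thesis by simp
  qed
  ultimately show ?thesis unfolding Let_def by blast
qed

end
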